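(* Let $(\mathcal A,I)$ be a hypergraph such that the poset $\mathcal A$ is finite and satisfies the weak intersection property, let $\{E_i\}_{i\in I}$ be finite sets, and let $F$ be the free sheaf on $X_{\mathcal A}$ over a commutative field $\mathbb K$ generated by the product functor $E$. Then $$\chi(\mathcal A;F)=\sum_{k=0}^\infty(-1)^k\dim_{\mathbb K}H^k(\mathcal U_{\mathcal A};F)=\sum_{\alpha,\beta\in\mathcal A}\mu_{\alpha\beta}N_\beta,$$ where $\mu$ is the Möbius function of $\mathcal A$ and $N_\alpha$ is the cardinality of $E_\alpha$ for each $\alpha\in\mathcal A$.
   Context: Hypergraph: $I$ is a set and $\mathcal A$ is a set of finite subsets of $I$, viewed as a poset category with an arrow $\alpha\to\beta$ iff $\beta\subseteq\alpha$. Weak intersection property: $\alpha\cap\alpha'\in\mathcal A$ for all $\alpha,\alpha'\in\mathcal A$ with $\alpha\cap\alpha'\ne\emptyset$. Product functor: $E_i$, $i\in I$, are non-empty sets, $E_\alpha=\prod_{i\in\alpha}E_i$ (a singleton if $\alpha=\emptyset$), with the coordinate projections $\pi^{\beta\alpha}:E_\alpha\to E_\beta$ for $\beta\subseteq\alpha$. Free sheaf: $F_\alpha=\mathbb K^{(E_\alpha)}$ is the vector space with basis $E_\alpha$, with maps $F_\alpha\to F_\beta$ induced by $\pi^{\beta\alpha}$ on bases, a covariant functor on $\mathcal A$. $X_{\mathcal A}$ is the set $\mathcal A$ with the lower Alexandrov topology, with basis $U_\alpha=\{\beta\in\mathcal A\mid\alpha\to\beta\}$, and $F$ is extended to a sheaf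 by $F(W)=\varprojlim_{\omega\in W}F_\omega$ for $W$ open. $\mathcal U_{\mathcal A}=\{U_\alpha\}_{\alpha\in\mathcal A}$, and $H^k(\mathcal U_{\mathcal A};F)$ is the Čech cohomology of this covering (cochains indexed by all sequences of members of the covering with non-empty intersection). $\chi(\mathcal A;F)$ is defined by the first equality. Möbius function: the function $\mu:\mathcal A\times\mathcal A\to\mathbb Z$ with $\mu_{\alpha\beta}=0$ if $\alpha\not\to\beta$, and, for all $\alpha,\gamma$ with $\alpha\to\gamma$, $\sum_{\beta:\alpha\to\beta\to\gamma}\mu_{\alpha\beta}=\sum_{\beta:\alpha\to\beta\to\gamma}\mu_{\beta\gamma}=\delta_{\alpha=\gamma}$ (equal to $1$ if $\alpha=\gamma$ and $0$ otherwise). *)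

theory Defs
  imports Complex_Main "HOL-Library.FuncSet" "HOL-Algebra.AbelCoset" "Jordan_Normal_Form.VS_Connect"
begin

definition hypergraph :: "'i set \<Rightarrow> 'i set set \<Rightarrow> bool" where
  "hypergraph I A \<longleftrightarrow> (\<forall>\<alpha>\<in>A. \<alpha> \<subseteq> I \<and> finite \<alpha>)"

definition weak_intersection_property :: "'i set set \<Rightarrow> bool" where
  "weak_intersection_property A \<longleftrightarrow>
     (\<forall>\<alpha>\<in>A. \<forall>\<alpha>'\<in>A. \<alpha> \<inter> \<alpha>' \<noteq> {} \<longrightarrow> \<alpha> \<inter> \<alpha>' \<in> A)"

text \<open>
  A hypergraph is a poset category with an arrow from \<open>\<alpha>\<close> to \<open>\<beta>\<close> iff \<open>\<beta> \<subseteq> \<alpha>\<close>.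
  The Moebius function of a finite poset exists and is unique on \<open>A \<times> A\<close>;
  its values outside \<open>A \<times> A\<close> are left unspecified.
\<close>

definition is_moebius :: "'i set set \<Rightarrow> ('i set \<Rightarrow> 'i set \<Rightarrow> int) \<Rightarrow> bool" where
  "is_moebius A \<mu> \<longleftrightarrow>
     (\<forall>\<alpha>\<in>A. \<forall>\<beta>\<in>A. \<not> \<beta> \<subseteq> \<alpha> \<longrightarrow> \<mu> \<alpha> \<beta> = 0) \<and>
     (\<forall>\<alpha>\<in>A. \<forall>\<gamma>\<in>A. \<gamma> \<subseteq> \<alpha> \<longrightarrow>
        (\<Sum>\<beta> | \<beta> \<in> A \<and> \<beta> \<subseteq> \<alpha> \<and> \<gamma> \<subseteq> \<beta>. \<mu> \<alpha> \<beta>) = (if \<alpha> = \<gamma> then 1 else 0) \<and>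
        (\<Sum>\<beta> | \<beta> \<in> A \<and> \<beta> \<subseteq> \<alpha> \<and> \<gamma> \<subseteq> \<beta>. \<mu> \<beta> \<gamma>) = (if \<alpha> = \<gamma> then 1 else 0))"

text \<open>
  The product functor is \<open>E\<^sub>\<alpha> = PiE \<alpha> E\<close>, with projection \<open>\<lambda>x. restrict x \<beta>\<close> onto
  \<open>E\<^sub>\<beta>\<close> for \<open>\<beta> \<subseteq> \<alpha>\<close>.  The vector space with basis \<open>X\<close> is the space of finitely
  supported functions on \<open>X\<close>, extended by \<open>0\<close>; \<open>free_map f\<close> is the linear map sending
  the basis vector of \<open>x\<close> to that of \<open>f x\<close>.
\<close>

definition free_space :: "'x set \<Rightarrow> ('x \<Rightarrow> 'k::field) set" where
  "free_space X = {v. finite {x. v x \<noteq> 0} \<and> {x. v x \<noteq> 0} \<subseteq> X}"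

definition free_map :: "('x \<Rightarrow> 'y) \<Rightarrow> ('x \<Rightarrow> 'k::field) \<Rightarrow> 'y \<Rightarrow> 'k" where
  "free_map f v = (\<lambda>y. \<Sum>x | v x \<noteq> 0 \<and> f x = y. v x)"

text \<open>
  The sections over \<open>W\<close> of the free sheaf: the inverse limit over \<open>W\<close> of the spaces
  \<open>free_space (PiE \<omega> E)\<close>, realised as compatible families extended by \<open>0\<close> outside \<open>W\<close>.
  It is only used for open \<open>W\<close>, i.e. for subsets of \<open>A\<close> closed under passing to smaller
  members of \<open>A\<close>.
\<close>

definition sections ::
    "('i \<Rightarrow> 'e set) \<Rightarrow> 'i set set \<Rightarrow> ('i set \<Rightarrow> ('i \<Rightarrow> 'e) \<Rightarrow> 'k::field) set" where
  "sections E W = {s.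
     (\<forall>\<omega>\<in>W. s \<omega> \<in> free_space (PiE \<omega> E)) \<and>
     (\<forall>\<omega>. \<omega> \<notin> W \<longrightarrow> s \<omega> = (\<lambda>_. 0)) \<and>
     (\<forall>\<alpha>\<in>W. \<forall>\<beta>\<in>W. \<beta> \<subseteq> \<alpha> \<longrightarrow> free_map (\<lambda>x. restrict x \<beta>) (s \<alpha>) = s \<beta>)}"

definition section_restrict ::
    "'i set set \<Rightarrow> ('i set \<Rightarrow> ('i \<Rightarrow> 'e) \<Rightarrow> 'k::field) \<Rightarrow> 'i set \<Rightarrow> ('i \<Rightarrow> 'e) \<Rightarrow> 'k" where
  "section_restrict W s = (\<lambda>\<omega>. if \<omega> \<in> W then s \<omega> else (\<lambda>_. 0))"

definition basic_open :: "'i set set \<Rightarrow> 'i set \<Rightarrow> 'i set set" where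
  "basic_open A \<alpha> = {\<beta>\<in>A. \<beta> \<subseteq> \<alpha>}"

definition basic_cover :: "'i set set \<Rightarrow> 'i set set set" where
  "basic_cover A = basic_open A ` A"

text \<open>
  A sequence of \<open>k + 1\<close> members of the covering is a list of length \<open>k + 1\<close>.  Cochains are
  extended by \<open>0\<close> to all lists.
\<close>

definition cech_simplices :: "'x set set \<Rightarrow> nat \<Rightarrow> 'x set list set" where
  "cech_simplices \<U> k = {w. length w = Suc k \<and> set w \<subseteq> \<U> \<and> \<Inter>(set w) \<noteq> {}}"

type_synonym ('i, 'e, 'k) cochain = "'i set set list \<Rightarrow> 'i set \<Rightarrow> ('i \<Rightarrow> 'e) \<Rightarrow> 'k"

definition cech_cochains ::
    "'i set set \<Rightarrow> ('i \<Rightarrow> 'e set) \<Rightarrow> nat \<Rightarrow> ('i, 'e, 'k::field) cochain set" where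
  "cech_cochains A E k = {f.
     (\<forall>w \<in> cech_simplices (basic_cover A) k. f w \<in> sections E (\<Inter>(set w))) \<and>
     (\<forall>w. w \<notin> cech_simplices (basic_cover A) k \<longrightarrow> f w = (\<lambda>_ _. 0))}"

definition cech_diff ::
    "'i set set \<Rightarrow> nat \<Rightarrow> ('i, 'e, 'k::field) cochain \<Rightarrow> ('i, 'e, 'k) cochain" where
  "cech_diff A k f = (\<lambda>w \<omega> x.
     if w \<in> cech_simplices (basic_cover A) (Suc k)
     then \<Sum>j\<le>Suc k. (-1) ^ j *
            section_restrict (\<Inter>(set w)) (f (take j w @ drop (Suc j) w)) \<omega> x
     else 0)"

definition cech_cocycles ::
    "'i set set \<Rightarrow> ('i \<Rightarrow> 'e set) \<Rightarrow> nat \<Rightarrow> ('i, 'e, 'k::field) cochain set" where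
  "cech_cocycles A E k = {f \<in> cech_cochains A E k. cech_diff A k f = (\<lambda>_ _ _. 0)}"

fun cech_coboundaries ::
    "'i set set \<Rightarrow> ('i \<Rightarrow> 'e set) \<Rightarrow> nat \<Rightarrow> ('i, 'e, 'k::field) cochain set" where
  "cech_coboundaries A E 0 = {\<lambda>_ _ _. 0}"
| "cech_coboundaries A E (Suc k) = cech_diff A k ` cech_cochains A E k"

definition cocycle_space ::
    "'i set set \<Rightarrow> ('i \<Rightarrow> 'e set) \<Rightarrow> nat \<Rightarrow> ('k::field, ('i, 'e, 'k) cochain) module" where
  "cocycle_space A E k =
     \<lparr>carrier = cech_cocycles A E k, mult = undefined, one = undefined,
      zero = (\<lambda>_ _ _. 0), add = (\<lambda>f g w \<omega> x. f w \<omega> x + g w \<omega> x),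
      smult = (\<lambda>c f w \<omega> x. c * f w \<omega> x)\<rparr>"

text \<open>The multiplicative fields of a module record carry no information.\<close>

definition quotient_module :: "('k, 'v, 'm) module_scheme \<Rightarrow> 'v set \<Rightarrow> ('k, 'v set) module" where
  "quotient_module V W =
     \<lparr>carrier = a_rcosets\<^bsub>V\<^esub> W, mult = undefined, one = undefined,
      zero = W, add = set_add V,
      smult = (\<lambda>c S. \<Union>v\<in>S. W +>\<^bsub>V\<^esub> (c \<odot>\<^bsub>V\<^esub> v))\<rparr>"

lemma (in vectorspace) quotient_module_vectorspace:
  assumes W: "VectorSpace.subspace K W V"
  shows "vectorspace K (quotient_module V W)"
proof -
  let ?Q = "quotient_module V W"
  have sm: "submodule K W V" using W by (simp add: is_module)
  have WV: "W \<subseteq> carrier V" using sm by (simp add: submodule_def)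
  have Wsm: "c \<odot>\<^bsub>V\<^esub> w \<in> W" if "c \<in> carrier K" "w \<in> W" for c w
    using sm that by (simp add: submodule_def)
  have Wadd: "v \<oplus>\<^bsub>V\<^esub> w \<in> W" if "v \<in> W" "w \<in> W" for v w
    using sm that by (auto simp: submodule_def)
  have sg: "additive_subgroup W V"
  proof (rule additive_subgroup.intro)
    show "subgroup W (add_monoid V)"
    proof (rule M.add.subgroupI)
      show "W \<subseteq> carrier V" by (rule WV)
      show "W \<noteq> {}" using sm by (auto simp: submodule_def)
      fix a assume a: "a \<in> W"
      then have aV: "a \<in> carrier V" using WV by auto
      have "(\<ominus>\<^bsub>K\<^esub> \<one>\<^bsub>K\<^esub>) \<odot>\<^bsub>V\<^esub> a \<in> W" by (rule Wsm) (use a in auto)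
      moreover have "(\<ominus>\<^bsub>K\<^esub> \<one>\<^bsub>K\<^esub>) \<odot>\<^bsub>V\<^esub> a = \<ominus>\<^bsub>V\<^esub> a"
        using aV by (simp add: smult_l_minus)
      ultimately show "\<ominus>\<^bsub>V\<^esub> a \<in> W" by simp
    next
      fix a b assume "a \<in> W" "b \<in> W"
      then show "a \<oplus>\<^bsub>V\<^esub> b \<in> W" using Wadd by simp
    qed
  qed
  interpret W: abelian_subgroup W V
    by (rule abelian_subgroupI3[OF sg]) (rule M.abelian_group_axioms)
  have car: "carrier ?Q = {a_r_coset V W v | v. v \<in> carrier V}"
    unfolding quotient_module_def by (auto simp: A_RCOSETS_def')
  have addQ: "a_r_coset V W v \<oplus>\<^bsub>?Q\<^esub> a_r_coset V W w = a_r_coset V W (v \<oplus>\<^bsub>V\<^esub> w)"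
    if "v \<in> carrier V" "w \<in> carrier V" for v w
    using that by (simp add: quotient_module_def W.a_rcos_sum)
  have smQ: "c \<odot>\<^bsub>?Q\<^esub> a_r_coset V W v = a_r_coset V W (c \<odot>\<^bsub>V\<^esub> v)"
    if c: "c \<in> carrier K" and v: "v \<in> carrier V" for c v
  proof -
    have "a_r_coset V W (c \<odot>\<^bsub>V\<^esub> u) = a_r_coset V W (c \<odot>\<^bsub>V\<^esub> v)" if u: "u \<in> a_r_coset V W v" for u
    proof -
      obtain h where h: "h \<in> W" "u = h \<oplus>\<^bsub>V\<^esub> v" using u by (auto simp: a_r_coset_def')
      have "c \<odot>\<^bsub>V\<^esub> u = (c \<odot>\<^bsub>V\<^esub> h) \<oplus>\<^bsub>V\<^esub> (c \<odot>\<^bsub>V\<^esub> v)"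
        using h c v WV by (auto simp: smult_r_distr)
      then have "c \<odot>\<^bsub>V\<^esub> u \<in> a_r_coset V W (c \<odot>\<^bsub>V\<^esub> v)"
        using Wsm[OF c h(1)] by (auto simp: a_r_coset_def')
      then show ?thesis
        using W.a_repr_independence'[of "c \<odot>\<^bsub>V\<^esub> u" "c \<odot>\<^bsub>V\<^esub> v"] c v by simp
    qed
    moreover have "v \<in> a_r_coset V W v" using v W.a_rcos_self by blast
    ultimately have "(\<Union>u\<in>a_r_coset V W v. a_r_coset V W (c \<odot>\<^bsub>V\<^esub> u)) = a_r_coset V W (c \<odot>\<^bsub>V\<^esub> v)"
      by blast
    then show ?thesis by (simp only: quotient_module_def module.simps)
  qed
  have zQ: "\<zero>\<^bsub>?Q\<^esub> = a_r_coset V W \<zero>\<^bsub>V\<^esub>"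
    by (simp add: quotient_module_def M.a_coset_add_zero WV)
  show ?thesis
  proof (rule vs_criteria)
    show "field K" ..
    show "\<zero>\<^bsub>?Q\<^esub> \<in> carrier ?Q" using zQ car by auto
    show "\<forall>v w. v \<in> carrier ?Q \<and> w \<in> carrier ?Q \<longrightarrow> v \<oplus>\<^bsub>?Q\<^esub> w \<in> carrier ?Q"
      unfolding car using addQ by auto
    show "\<forall>v\<in>carrier ?Q. \<exists>n\<in>carrier ?Q. v \<oplus>\<^bsub>?Q\<^esub> n = \<zero>\<^bsub>?Q\<^esub>"
    proof
      fix v assume "v \<in> carrier ?Q"
      then obtain u where u: "u \<in> carrier V" "v = a_r_coset V W u" unfolding car by auto
      then show "\<exists>n\<in>carrier ?Q. v \<oplus>\<^bsub>?Q\<^esub> n = \<zero>\<^bsub>?Q\<^esub>"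
        by (intro bexI[of _ "a_r_coset V W (\<ominus>\<^bsub>V\<^esub> u)"])
          (auto simp: addQ zQ car M.r_neg)
    qed
    show "\<forall>c v. c \<in> carrier K \<and> v \<in> carrier ?Q \<longrightarrow> c \<odot>\<^bsub>?Q\<^esub> v \<in> carrier ?Q"
      unfolding car mem_Collect_eq by (metis smQ smult_closed)
    show "\<forall>v w. v \<in> carrier ?Q \<and> w \<in> carrier ?Q \<longrightarrow> v \<oplus>\<^bsub>?Q\<^esub> w = w \<oplus>\<^bsub>?Q\<^esub> v"
      unfolding car by (auto simp: addQ M.a_comm)
    show "\<forall>v w x. v \<in> carrier ?Q \<and> w \<in> carrier ?Q \<and> x \<in> carrier ?Q \<longrightarrow>
        v \<oplus>\<^bsub>?Q\<^esub> w \<oplus>\<^bsub>?Q\<^esub> x = v \<oplus>\<^bsub>?Q\<^esub> (w \<oplus>\<^bsub>?Q\<^esub> x)"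
      unfolding car by (auto simp: addQ M.a_assoc)
    show "\<forall>v\<in>carrier ?Q. v \<oplus>\<^bsub>?Q\<^esub> \<zero>\<^bsub>?Q\<^esub> = v" unfolding car zQ by (auto simp: addQ)
    show "\<forall>a b v. a \<in> carrier K \<and> b \<in> carrier K \<and> v \<in> carrier ?Q \<longrightarrow>
        (a \<otimes>\<^bsub>K\<^esub> b) \<odot>\<^bsub>?Q\<^esub> v = a \<odot>\<^bsub>?Q\<^esub> (b \<odot>\<^bsub>?Q\<^esub> v)"
      unfolding car by (auto simp: smQ smult_assoc1)
    show "\<forall>v\<in>carrier ?Q. \<one>\<^bsub>K\<^esub> \<odot>\<^bsub>?Q\<^esub> v = v" unfolding car by (auto simp: smQ)
    show "\<forall>a b v. a \<in> carrier K \<and> b \<in> carrier K \<and> v \<in> carrier ?Q \<longrightarrow>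
        (a \<oplus>\<^bsub>K\<^esub> b) \<odot>\<^bsub>?Q\<^esub> v = a \<odot>\<^bsub>?Q\<^esub> v \<oplus>\<^bsub>?Q\<^esub> b \<odot>\<^bsub>?Q\<^esub> v"
      unfolding car by (auto simp: smQ addQ smult_l_distr)
    show "\<forall>a v w. a \<in> carrier K \<and> v \<in> carrier ?Q \<and> w \<in> carrier ?Q \<longrightarrow>
        a \<odot>\<^bsub>?Q\<^esub> (v \<oplus>\<^bsub>?Q\<^esub> w) = a \<odot>\<^bsub>?Q\<^esub> v \<oplus>\<^bsub>?Q\<^esub> a \<odot>\<^bsub>?Q\<^esub> w"
      unfolding car by (auto simp: smQ addQ smult_r_distr)
  qed
qed

definition cech_cohomology ::
    "'i set set \<Rightarrow> ('i \<Rightarrow> 'e set) \<Rightarrow> nat \<Rightarrow> ('k::field, ('i, 'e, 'k) cochain set) module" where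
  "cech_cohomology A E k = quotient_module (cocycle_space A E k) (cech_coboundaries A E k)"

definition cech_betti ::
    "'k::field itself \<Rightarrow> 'i set set \<Rightarrow> ('i \<Rightarrow> 'e set) \<Rightarrow> nat \<Rightarrow> nat" where
  "cech_betti K A E k =
     vectorspace.dim class_ring (cech_cohomology A E k :: ('k, ('i, 'e, 'k) cochain set) module)"

definition euler_char :: "'k::field itself \<Rightarrow> 'i set set \<Rightarrow> ('i \<Rightarrow> 'e set) \<Rightarrow> int" where
  "euler_char K A E = (\<Sum>k. (-1) ^ k * int (cech_betti K A E k))"

end

theory Submission
  imports Defs "HOL-Library.Function_Algebras"
begin

text \<open>
  Intersections of members of the covering are empty or again members of it, so the degree
  \<open>k\<close> cochains are a product of spaces \<open>F\<^sub>\<gamma>\<close> of dimension \<open>N\<^sub>\<gamma>\<close>, one for each sequence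
  of length \<open>k + 1\<close>. Fix a total order on the covering. Restriction to strictly
  increasing sequences preserves cohomology: treat the members one at a time, contracting
  the sequences in which the current member \<open>v\<close> occurs but is not at its place by inserting a further
  \<open>v\<close> at that place, which does not change the intersection. The increasing complex is finite-dimensional
  and bounded, so the Euler characteristic is the sum of \<open>(-1)\<^bsup>card S - 1\<^esup> N\<^sub>\<gamma>\<close> over the
  simplices \<open>S\<close> of the nerve, with \<open>\<gamma>\<close> the common intersection. The total coefficient of \<open>N\<^sub>\<gamma>\<close>
  and the number \<open>\<Sum>\<^sub>\<alpha> \<mu>\<^sub>\<alpha>\<^sub>\<gamma>\<close> agree, since summing either of them over the
  \<open>\<gamma>\<close> above a given member of \<open>A\<close> gives \<open>1\<close>.
\<close>

section \<open>Dimensions of subspaces\<close>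

text \<open>Independent subsets of \<open>U\<close> remain independent in \<open>V\<close>, so their
  sizes are bounded by \<open>dim\<close>. A maximal one therefore exists, and it generates
  \<open>U\<close>.\<close>

lemma (in vectorspace) subspace_fin_dim:
  assumes U: "VectorSpace.subspace K U V" and fd: fin_dim
  shows "vectorspace.fin_dim K (vs U)"
proof -
  have sm: "submodule K U V" using U by simp
  then have UV: "U \<subseteq> carrier V" by (simp add: submodule_def)
  interpret U: vectorspace K "vs U" using subspace_is_vs[OF U] .
  let ?P = "\<lambda>A. A \<subseteq> carrier (vs U) \<and> U.lin_indpt A"
  have P: "finite A \<and> card A \<le> dim" if A: "?P A" for A
  proof -
    have "lin_indpt A" using A span_li_not_depend(2)[OF _ sm, of A] by simp
    moreover have "A \<subseteq> carrier V" using A UV by auto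
    ultimately show ?thesis using li_le_dim[OF fd, of A] by blast
  qed
  have "?P {}" by (simp add: U.lin_dep_def)
  then obtain B where B: "finite B" "maximal B ?P"
    using maximal_exists[of ?P dim "{}"] P by blast
  then have "U.gen_set B" using U.max_li_is_gen[of B] by blast
  then show ?thesis using B by (auto simp: U.fin_dim_def maximal_def)
qed

text \<open>A bridge between subspaces in the sense of \<open>vector_space\<close>, where the
  ambient space is a whole type, and the carrier-based records for which dimension is
  defined.\<close>

definition sub_mod :: "('k::field \<Rightarrow> 'v::ab_group_add \<Rightarrow> 'v) \<Rightarrow> 'v set \<Rightarrow> ('k, 'v) module" where
  "sub_mod s W = \<lparr>carrier = W, mult = undefined, one = undefined,
     zero = 0, add = (+), smult = s\<rparr>"

definition sdim :: "('k::field \<Rightarrow> 'v::ab_group_add \<Rightarrow> 'v) \<Rightarrow> 'v set \<Rightarrow> nat" where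
  "sdim s W = vectorspace.dim class_ring (sub_mod s W)"

definition sfin :: "('k::field \<Rightarrow> 'v::ab_group_add \<Rightarrow> 'v) \<Rightarrow> 'v set \<Rightarrow> bool" where
  "sfin s W = vectorspace.fin_dim class_ring (sub_mod s W)"

lemma sub_mod_simps [simp]:
  "carrier (sub_mod s W) = W" "zero (sub_mod s W) = 0" "add (sub_mod s W) = (+)"
  "module.smult (sub_mod s W) = s" "(sub_mod s W)\<lparr>carrier := U\<rparr> = sub_mod s U"
  by (simp_all add: sub_mod_def)

context vector_space
begin

lemma vectorspace_sub_mod:
  assumes W: "subspace W"
  shows "vectorspace class_ring (sub_mod scale W)"
proof (rule vs_criteria)
  show "field (class_ring :: 'a ring)" by (rule class_field)
  show "\<forall>v\<in>carrier (sub_mod scale W). \<exists>n\<in>carrier (sub_mod scale W).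
      v \<oplus>\<^bsub>sub_mod scale W\<^esub> n = \<zero>\<^bsub>sub_mod scale W\<^esub>"
    using subspace_neg[OF W] by (auto intro!: bexI[of _ "- _"])
qed (use W in \<open>auto simp: subspace_def scale_left_distrib scale_right_distrib algebra_simps\<close>)

lemma vectorspace_subspace_sub_mod:
  assumes "subspace W" "subspace U" "U \<subseteq> W"
  shows "VectorSpace.subspace class_ring U (sub_mod scale W)"
proof -
  interpret W: vectorspace class_ring "sub_mod scale W"
    by (rule vectorspace_sub_mod[OF assms(1)])
  have "LinearCombinations.submodule class_ring U (sub_mod scale W)"
    by (rule LinearCombinations.submodule.intro, rule W.module_axioms)
      (use assms in \<open>auto simp: subspace_def\<close>)
  then show ?thesis
    by (simp add: VectorSpace.subspace_def W.vectorspace_axioms)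
qed

lemma sfin_subspace:
  assumes "subspace W" "subspace U" "U \<subseteq> W" "sfin scale W"
  shows "sfin scale U"
  using vectorspace.subspace_fin_dim[OF vectorspace_sub_mod[OF assms(1)]
      vectorspace_subspace_sub_mod[OF assms(1-3)]] assms(4)
  by (simp add: sfin_def)

end

lemma linear_map_sub_mod:
  assumes T: "Vector_Spaces.linear s1 s2 T"
    and U: "module.subspace s1 U" and W: "module.subspace s2 W" and TU: "T ` U \<subseteq> W"
  shows "linear_map class_ring (sub_mod s1 U) (sub_mod s2 W) T"
proof -
  interpret T: Vector_Spaces.linear s1 s2 T by (rule T)
  interpret U: vectorspace class_ring "sub_mod s1 U" by (rule T.vs1.vectorspace_sub_mod[OF U])
  interpret W: vectorspace class_ring "sub_mod s2 W" by (rule T.vs2.vectorspace_sub_mod[OF W])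
  show ?thesis
    by unfold_locales (use TU in \<open>auto simp: LinearCombinations.module_hom_def T.add T.scale\<close>)
qed

text \<open>Rank-nullity for the restriction of \<open>T\<close> to \<open>U\<close>, with the image
  itself taken as the codomain.\<close>

lemma
  assumes T: "Vector_Spaces.linear s1 s2 T" and U: "module.subspace s1 U" and fin: "sfin s1 U"
  shows sfin_image: "sfin s2 (T ` U)"
    and sdim_image_kernel: "sdim s1 U = sdim s2 (T ` U) + sdim s1 {x \<in> U. T x = 0}"
proof -
  interpret T: Vector_Spaces.linear s1 s2 T by (rule T)
  interpret L: linear_map class_ring "sub_mod s1 U" "sub_mod s2 (T ` U)" T
    by (rule linear_map_sub_mod[OF T U T.subspace_image[OF U]]) simp
  have fd: "L.V.fin_dim" using fin by (simp add: sfin_def)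
  show "sfin s2 (T ` U)" using L.rank_nullity_main(2)[OF fd] by (simp add: sfin_def)
  show "sdim s1 U = sdim s2 (T ` U) + sdim s1 {x \<in> U. T x = 0}"
    using L.rank_nullity_main(1)[OF fd] by (simp add: sdim_def L.im_def L.ker_def)
qed

lemma (in vector_space) sdim_zero [simp]: "sdim scale {0} = 0" "sfin scale {0}"
proof -
  interpret Z: vectorspace class_ring "sub_mod scale {0}"
    by (rule vectorspace_sub_mod) (simp add: subspace_def)
  have g: "Z.gen_set {\<zero>\<^bsub>sub_mod scale {0}\<^esub>}"
    using Z.in_own_span[of "{0}"] Z.span_is_subset2[of "{0}"] by auto
  show "sdim scale {0} = 0" using Z.dim0I[OF g] by (simp add: sdim_def)
  show "sfin scale {0}" using g by (auto simp: sfin_def Z.fin_dim_def)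
qed

lemma sdim_inj_image:
  assumes T: "Vector_Spaces.linear s1 s2 T" and U: "module.subspace s1 U" and fin: "sfin s1 U"
    and inj: "\<And>x. x \<in> U \<Longrightarrow> T x = 0 \<Longrightarrow> x = 0"
  shows "sdim s2 (T ` U) = sdim s1 U"
proof -
  interpret T: Vector_Spaces.linear s1 s2 T by (rule T)
  have "{x \<in> U. T x = 0} = {0}"
    using inj T.vs1.subspace_0[OF U] T.zero by auto
  then show ?thesis using sdim_image_kernel[OF T U fin] by simp
qed

lemma vector_space_fun: "vector_space (\<lambda>c (f :: 'x \<Rightarrow> 'k::field) x. c * f x)"
  by unfold_locales (simp_all add: fun_eq_iff distrib_left distrib_right)

text \<open>An enumeration of \<open>S\<close> identifies these functions with the vectors of length
  \<open>card S\<close>, whose dimension is known.\<close>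

lemma
  fixes S :: "'x set"
  assumes "finite S"
  defines "s \<equiv> (\<lambda>c (f :: 'x \<Rightarrow> 'k::field) x. c * f x)"
  shows sfin_supported: "sfin s {f. \<forall>x. x \<notin> S \<longrightarrow> f x = 0}"
    and sdim_supported: "sdim s {f. \<forall>x. x \<notin> S \<longrightarrow> f x = 0} = card S"
proof -
  let ?W = "{f :: 'x \<Rightarrow> 'k. \<forall>x. x \<notin> S \<longrightarrow> f x = 0}" and ?n = "card S"
  interpret s: vector_space s unfolding s_def by (rule vector_space_fun)
  obtain g where g: "bij_betw g S {..<?n}"
    using ex_bij_betw_finite_nat[OF assms(1)] by (auto simp: lessThan_atLeast0)
  let ?h = "inv_into S g"
  have h: "?h i \<in> S" "g (?h i) = i" if "i < ?n" for i
    using bij_betw_inv_into_right[OF g, of i] inv_into_into[of i g S] g that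
    by (auto simp: bij_betw_def)
  define T where "T v = (\<lambda>x. if x \<in> S then v $ g x else 0)" for v :: "'k vec"
  let ?V = "module_vec TYPE('k) ?n"
  interpret V: vectorspace class_ring ?V by (rule vec_vs)
  have sub: "s.subspace ?W" unfolding s.subspace_def by (auto simp: s_def)
  interpret W: vectorspace class_ring "sub_mod s ?W" by (rule s.vectorspace_sub_mod[OF sub])
  have gS: "g x < ?n" if "x \<in> S" for x using g that by (auto simp: bij_betw_def)
  interpret L: linear_map class_ring ?V "sub_mod s ?W" T
    by unfold_locales
      (auto simp: LinearCombinations.module_hom_def T_def s_def fun_eq_iff gS module_vec_simps)
  have inj: "inj_on T (carrier ?V)"
  proof (rule inj_onI)
    fix v w assume v: "v \<in> carrier ?V" and w: "w \<in> carrier ?V" and e: "T v = T w"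
    show "v = w"
    proof (rule eq_vecI)
      fix i assume "i < dim_vec w"
      then have i: "i < ?n" using w by (simp add: module_vec_simps)
      show "v $ i = w $ i" using fun_cong[OF e, of "?h i"] h[OF i] by (simp add: T_def)
    qed (use v w in \<open>simp add: module_vec_simps\<close>)
  qed
  have surj: "T ` carrier ?V = carrier (sub_mod s ?W)"
  proof
    show "carrier (sub_mod s ?W) \<subseteq> T ` carrier ?V"
    proof
      fix f assume f: "f \<in> carrier (sub_mod s ?W)"
      have "f = T (vec ?n (\<lambda>i. f (?h i)))"
        using f gS bij_betw_inv_into_left[OF g] by (auto simp: T_def fun_eq_iff)
      then show "f \<in> T ` carrier ?V" by (auto simp: module_vec_simps)
    qed
  qed (auto simp: T_def)
  show "sfin s ?W" using L.surj_fin_dim[OF vec_space.fin_dim surj] by (simp add: sfin_def)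
  show "sdim s ?W = ?n" using L.dim_eq[OF vec_space.fin_dim inj surj] by (simp add: sdim_def vec_space.dim_is_n)
qed

text \<open>Sending a vector to its coset is linear and onto, with kernel \<open>B\<close>, so
  rank-nullity applies. The dimension formula is additive to avoid truncated subtraction.\<close>

lemma (in vector_space)
  assumes Z: "subspace Z" and B: "subspace B" and BZ: "B \<subseteq> Z" and fin: "sfin scale Z"
  shows fin_dim_quotient_module:
      "vectorspace.fin_dim class_ring (quotient_module (sub_mod scale Z) B)"
    and dim_quotient_module:
      "vectorspace.dim class_ring (quotient_module (sub_mod scale Z) B) + sdim scale B = sdim scale Z"
proof -
  let ?V = "sub_mod scale Z" and ?Q = "quotient_module (sub_mod scale Z) B"
  interpret V: vectorspace class_ring ?V by (rule vectorspace_sub_mod[OF Z])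
  have sub: "VectorSpace.subspace class_ring B ?V"
    by (rule vectorspace_subspace_sub_mod[OF Z B BZ])
  interpret Q: vectorspace class_ring ?Q by (rule V.quotient_module_vectorspace[OF sub])
  let ?T = "\<lambda>v. a_r_coset ?V B v"
  have T: "?T v = {b + v | b. b \<in> B}" for v by (auto simp: a_r_coset_def')
  have mem: "u \<in> ?T v \<longleftrightarrow> u - v \<in> B" for u v
    unfolding T by (auto simp: algebra_simps intro!: exI[of _ "u - v"])
  have eq: "?T u = ?T v \<longleftrightarrow> u - v \<in> B" for u v
  proof
    assume "?T u = ?T v"
    then show "u - v \<in> B" using mem[of u u] mem[of u v] subspace_0[OF B] by simp
  next
    assume uv: "u - v \<in> B"
    have "x - u \<in> B \<longleftrightarrow> x - v \<in> B" for x
      using subspace_add[OF B _ uv, of "x - u"] subspace_diff[OF B _ uv, of "x - v"] by auto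
    then show "?T u = ?T v" using mem by blast
  qed
  have car: "carrier ?Q = ?T ` Z"
    by (auto simp: quotient_module_def A_RCOSETS_def')
  have add: "?T u \<oplus>\<^bsub>?Q\<^esub> ?T v = ?T (u + v)" for u v
  proof -
    have "x \<in> set_add ?V (?T u) (?T v) \<longleftrightarrow> x - (u + v) \<in> B" for x
    proof
      assume "x \<in> set_add ?V (?T u) (?T v)"
      then obtain a b where "x = a + b" "a - u \<in> B" "b - v \<in> B"
        by (auto simp: set_add_def' mem)
      then show "x - (u + v) \<in> B"
        using subspace_add[OF B, of "a - u" "b - v"] by (simp add: algebra_simps)
    next
      assume "x - (u + v) \<in> B"
      then have "x - v \<in> ?T u" "v \<in> ?T v" "x = (x - v) + v"
        using subspace_0[OF B] by (auto simp: mem algebra_simps)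
      then show "x \<in> set_add ?V (?T u) (?T v)" unfolding set_add_def' by fastforce
    qed
    then show ?thesis using mem by (auto simp: quotient_module_def)
  qed
  have smult: "c \<odot>\<^bsub>?Q\<^esub> ?T v = ?T (scale c v)" for c v
  proof -
    have "?T (scale c u) = ?T (scale c v)" if "u \<in> ?T v" for u
      using that subspace_scale[OF B, of "u - v" c] by (simp add: mem eq scale_right_diff_distrib)
    moreover have "v \<in> ?T v" using mem subspace_0[OF B] by simp
    ultimately have "(\<Union>u\<in>?T v. ?T (scale c u)) = ?T (scale c v)" by blast
    then show ?thesis by (simp add: quotient_module_def)
  qed
  interpret L: linear_map class_ring ?V ?Q ?T
    by unfold_locales (auto simp: LinearCombinations.module_hom_def car add smult)
  have ker: "L.ker = B"
  proof -
    have "\<zero>\<^bsub>?Q\<^esub> = ?T 0" by (simp add: quotient_module_def T)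
    then show ?thesis using BZ by (auto simp: L.ker_def eq)
  qed
  have fd: V.fin_dim using fin by (simp add: sfin_def)
  show "Q.fin_dim" using L.rank_nullity_main(2)[OF fd] car by simp
  have "L.im = carrier ?Q" by (simp add: L.im_def car)
  then show "Q.dim + sdim scale B = sdim scale Z"
    using L.rank_nullity_main(1)[OF fd] ker by (simp add: sdim_def)
qed

section \<open>Betti numbers of cochain complexes\<close>

text \<open>All degrees share one ambient vector space, on the whole of which each
  \<open>d k\<close> is linear. Being a complex is demanded only on the subspaces
  \<open>C k\<close>.\<close>

locale cochain_complex = vector_space scale
  for scale :: "'k::field \<Rightarrow> 'v::ab_group_add \<Rightarrow> 'v" +
  fixes C :: "nat \<Rightarrow> 'v set" and d :: "nat \<Rightarrow> 'v \<Rightarrow> 'v"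
  assumes subspace_C: "subspace (C k)"
    and linear_d: "Vector_Spaces.linear scale scale (d k)"
    and d_C: "x \<in> C k \<Longrightarrow> d k x \<in> C (Suc k)"
    and d_d: "x \<in> C k \<Longrightarrow> d (Suc k) (d k x) = 0"
    and sfin_C: "sfin scale (C k)"
begin

definition cocycles :: "nat \<Rightarrow> 'v set" where
  "cocycles k = {x \<in> C k. d k x = 0}"

fun coboundaries :: "nat \<Rightarrow> 'v set" where
  "coboundaries 0 = {0}"
| "coboundaries (Suc k) = d k ` C k"

text \<open>The subtraction of natural numbers is never truncated, by
  \<open>sdim_coboundaries_le\<close>.\<close>

definition betti :: "nat \<Rightarrow> nat" where
  "betti k = sdim scale (cocycles k) - sdim scale (coboundaries k)"

lemma subspace_cocycles: "subspace (cocycles k)"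
proof -
  interpret d: Vector_Spaces.linear scale scale "d k" by (rule linear_d)
  show ?thesis
    using subspace_C[of k] by (auto simp: cocycles_def subspace_def d.add d.scale d.zero)
qed

lemma subspace_coboundaries: "subspace (coboundaries k)"
proof (cases k)
  case (Suc l)
  interpret d: Vector_Spaces.linear scale scale "d l" by (rule linear_d)
  show ?thesis using Suc d.subspace_image[OF subspace_C] by simp
qed (simp add: subspace_def)

lemma coboundaries_subset: "coboundaries k \<subseteq> cocycles k"
proof (cases k)
  case 0
  interpret d: Vector_Spaces.linear scale scale "d 0" by (rule linear_d)
  show ?thesis using 0 subspace_0[OF subspace_C] by (simp add: cocycles_def d.zero)
qed (auto simp: cocycles_def d_C d_d)

lemma sfin_cocycles: "sfin scale (cocycles k)"
  by (rule sfin_subspace[OF subspace_C[of k] subspace_cocycles _ sfin_C]) (auto simp: cocycles_def)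

lemma sfin_coboundaries: "sfin scale (coboundaries k)"
  by (rule sfin_subspace[OF subspace_cocycles subspace_coboundaries coboundaries_subset sfin_cocycles])

lemma fin_dim_cohomology:
  "vectorspace.fin_dim class_ring (quotient_module (sub_mod scale (cocycles k)) (coboundaries k))"
  by (rule fin_dim_quotient_module[OF subspace_cocycles subspace_coboundaries
        coboundaries_subset sfin_cocycles])

lemma dim_cohomology:
  "vectorspace.dim class_ring (quotient_module (sub_mod scale (cocycles k)) (coboundaries k)) = betti k"
  and sdim_coboundaries_le: "sdim scale (coboundaries k) \<le> sdim scale (cocycles k)"
  using dim_quotient_module[OF subspace_cocycles subspace_coboundaries
        coboundaries_subset sfin_cocycles, of k] by (auto simp: betti_def)

lemma sdim_C: "sdim scale (C k) = sdim scale (coboundaries (Suc k)) + sdim scale (cocycles k)"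
  using sdim_image_kernel[OF linear_d subspace_C sfin_C, of k k] by (simp add: cocycles_def)

lemma
  assumes C: "\<And>k. n \<le> k \<Longrightarrow> C k = {0}"
  shows betti_eq_0: "n \<le> k \<Longrightarrow> betti k = 0"
    and euler_poincare: "(\<Sum>k<n. (-1) ^ k * int (betti k)) = (\<Sum>k<n. (-1) ^ k * int (sdim scale (C k)))"
proof -
  have cob: "coboundaries k = {0}" if "n \<le> k" for k
    using coboundaries_subset[of k] subspace_0[OF subspace_coboundaries[of k]] C[OF that]
    by (auto simp: cocycles_def)
  show "betti k = 0" if "n \<le> k"
    using sdim_C[of k] cob[OF that] C[OF that] by (simp add: betti_def)
  \<comment> \<open>The ranks of the differentials cancel in pairs, because consecutive degrees
    carry opposite signs and \<open>coboundaries 0\<close> is zero. A partial sum leaves one rank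
    over, which disappears at \<open>m = n\<close>.\<close>
  have "(\<Sum>k<m. (-1) ^ k * int (betti k)) =
      (\<Sum>k<m. (-1) ^ k * int (sdim scale (C k))) + (-1) ^ m * int (sdim scale (coboundaries m))" for m
    by (induction m)
      (use sdim_coboundaries_le in \<open>auto simp: sdim_C betti_def of_nat_diff algebra_simps\<close>)
  from this[of n] show "(\<Sum>k<n. (-1) ^ k * int (betti k)) = (\<Sum>k<n. (-1) ^ k * int (sdim scale (C k)))"
    using cob[of n] by simp
qed

end

text \<open>\<open>p\<close> maps coboundaries onto coboundaries by \<open>surj\<close> and
  \<open>comm\<close>, and cocycles onto cocycles by \<open>lift\<close>. By \<open>ker_0\<close>
  and \<open>ker_Suc\<close> its kernel on the cocycles consists of coboundaries. Rank-nullity on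
  both spaces then leaves the difference of the dimensions unchanged.\<close>

lemma betti_eq:
  assumes "cochain_complex scale C d" and "cochain_complex scale C' d'"
    and p: "\<And>k. Vector_Spaces.linear scale scale (p k)"
    and surj: "\<And>k. p k ` C k = C' k"
    and comm: "\<And>k x. x \<in> C k \<Longrightarrow> p (Suc k) (d k x) = d' k (p k x)"
    and ker_0: "\<And>x. x \<in> C 0 \<Longrightarrow> p 0 x = 0 \<Longrightarrow> x = 0"
    and ker_Suc: "\<And>k x. x \<in> C (Suc k) \<Longrightarrow> d (Suc k) x = 0 \<Longrightarrow> p (Suc k) x = 0 \<Longrightarrow>
      \<exists>y\<in>C k. d k y = x"
    and lift: "\<And>k x. x \<in> C' k \<Longrightarrow> d' k x = 0 \<Longrightarrow> \<exists>z\<in>C k. d k z = 0 \<and> p k z = x"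
  shows "cochain_complex.betti scale C d k = cochain_complex.betti scale C' d' k"
proof -
  interpret C: cochain_complex scale C d by fact
  interpret C': cochain_complex scale C' d' by fact
  interpret p: Vector_Spaces.linear scale scale "p l" for l by (rule p)
  have img_cob: "p k ` C.coboundaries k = C'.coboundaries k"
  proof (cases k)
    case (Suc l)
    then show ?thesis using comm surj[of l] by (force simp: image_image)
  qed (simp add: p.zero)
  have "p k ` C.cocycles k \<subseteq> C'.cocycles k"
    using comm[of _ k] surj[of k] by (force simp: C.cocycles_def C'.cocycles_def p.zero)
  moreover have "C'.cocycles k \<subseteq> p k ` C.cocycles k"
    using lift[of _ k] by (force simp: C.cocycles_def C'.cocycles_def)
  ultimately have img_coc: "p k ` C.cocycles k = C'.cocycles k" by blast
  have ker: "{x \<in> C.cocycles k. p k x = 0} = {x \<in> C.coboundaries k. p k x = 0}"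
  proof (cases k)
    case 0
    then show ?thesis
      using ker_0 C.coboundaries_subset[of 0] by (auto simp: C.cocycles_def p.zero)
  next
    case (Suc l)
    then show ?thesis
      using ker_Suc[of _ l] C.coboundaries_subset[of k] by (fastforce simp: C.cocycles_def)
  qed
  show ?thesis
    using sdim_image_kernel[OF p[of k] C.subspace_cocycles C.sfin_cocycles, of k]
      sdim_image_kernel[OF p[of k] C.subspace_coboundaries C.sfin_coboundaries, of k]
    unfolding img_cob img_coc ker C.betti_def C'.betti_def
    by simp
qed

section \<open>The simplicial coboundary and its contraction\<close>

text \<open>The alternating sum over the faces of a list, see \<open>delta_eq_sum\<close>. The
  recursive form lets its identities be proved by induction on the list with \<open>g\<close>
  generalised.\<close>

fun delta :: "('x list \<Rightarrow> 'a::ab_group_add) \<Rightarrow> 'x list \<Rightarrow> 'a" where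
  "delta g [] = 0"
| "delta g (x # w) = g w - delta (\<lambda>u. g (x # u)) w"

lemma delta_diff: "delta (\<lambda>u. f u - g u) w = delta f w - delta g w"
  by (induction w arbitrary: f g) auto

lemma delta_eq_sum:
  fixes g :: "'x list \<Rightarrow> 'a::ring_1"
  shows "delta g w = (\<Sum>j<length w. (-1) ^ j * g (take j w @ drop (Suc j) w))"
  by (induction w arbitrary: g) (auto simp: sum.lessThan_Suc_shift sum_negf simp del: sum.lessThan_Suc)

text \<open>In the induction step the two copies of \<open>delta g w\<close> cancel, and what
  remains is the claim for \<open>\<lambda>u. g (x # u)\<close>.\<close>

lemma delta_delta: "delta (delta g) w = 0"
  by (induction w arbitrary: g) (auto simp: delta_diff)

lemma delta_cong:
  assumes "\<And>j. j < length w \<Longrightarrow> f (take j w @ drop (Suc j) w) = g (take j w @ drop (Suc j) w)"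
  shows "delta f w = delta g w"
  using assms
proof (induction w arbitrary: f g)
  case (Cons x w)
  have "f w = g w" using Cons.prems[of 0] by simp
  moreover have "delta (\<lambda>u. f (x # u)) w = delta (\<lambda>u. g (x # u)) w"
    using Cons.prems[of "Suc _"] by (intro Cons.IH) auto
  ultimately show ?case by simp
qed simp

text \<open>The change of sign at each entry passed makes the insertion of \<open>v\<close> a
  contracting homotopy for \<open>delta\<close>.\<close>

fun homotopy :: "('x \<Rightarrow> nat) \<Rightarrow> nat \<Rightarrow> 'x \<Rightarrow> ('x list \<Rightarrow> 'a::ab_group_add) \<Rightarrow> 'x list \<Rightarrow> 'a" where
  "homotopy r j v g [] = g [v]"
| "homotopy r j v g (x # w) = (if r x < j then - homotopy r j v (\<lambda>u. g (x # u)) w else g (v # x # w))"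

text \<open>Only the later entry is compared with \<open>j\<close>: an entry of rank below
  \<open>j\<close> exceeds everything before it, so no entry of rank at least \<open>j\<close> can
  precede it.\<close>

definition sorted_below :: "('x \<Rightarrow> nat) \<Rightarrow> nat \<Rightarrow> 'x list \<Rightarrow> bool" where
  "sorted_below r j w \<longleftrightarrow> sorted_wrt (\<lambda>x y. r y < j \<longrightarrow> r x < r y) w"

lemma homotopy_diff:
  "homotopy r j v (\<lambda>u. f u - g u) w = homotopy r j v f w - homotopy r j v g w"
  by (induction w arbitrary: f g) auto

text \<open>A list that is \<open>sorted_below\<close> is an increasing list of elements of rank below \<open>j\<close>, followed by
  elements of rank at least \<open>j\<close>; the homotopy inserts \<open>v\<close> between the two parts.\<close>

lemma delta_homotopy:
  assumes "sorted_below r j w"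
  shows "delta (homotopy r j v g) w + homotopy r j v (delta g) w = g w"
  using assms
proof (induction w arbitrary: g)
  case (Cons x w)
  have w: "sorted_below r j w" using Cons.prems by (simp add: sorted_below_def)
  show ?case
  proof (cases "r x < j")
    case True
    have "delta (homotopy r j v (\<lambda>u. g (x # u))) w + homotopy r j v (delta (\<lambda>u. g (x # u))) w = g (x # w)"
      by (rule Cons.IH[OF w])
    moreover have "delta (\<lambda>u. - homotopy r j v (\<lambda>u. g (x # u)) u) w = - delta (homotopy r j v (\<lambda>u. g (x # u))) w"
      using delta_diff[of "\<lambda>_. 0"  "homotopy r j v (\<lambda>u. g (x # u))" w] delta_diff[of "\<lambda>_. 0" "\<lambda>_. 0" w] by simp
    ultimately show ?thesis using True by (simp add: homotopy_diff algebra_simps)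
  next
    case False
    \<comment> \<open>No entry of rank below \<open>j\<close> can follow \<open>x\<close>, so in
      \<open>w\<close> too the insertion happens at the front. This term cancels the face of
      \<open>v # x # w\<close> that omits \<open>x\<close>.\<close>
    then have "homotopy r j v g w = g (v # w)"
      using Cons.prems by (cases w) (auto simp: sorted_below_def)
    then show ?thesis using False by simp
  qed
qed simp

text \<open>The splitting depends on \<open>w\<close> alone, so one choice of \<open>s\<close> and
  \<open>u\<close> serves all functions \<open>g\<close>, for example
  \<open>delta g\<close>.\<close>

lemma homotopy_eq_insert:
  assumes "sorted_below r j w"
  obtains s u where "w = s @ u" "\<forall>x\<in>set s. r x < j" "\<forall>x\<in>set u. j \<le> r x"
    "\<And>g :: 'x list \<Rightarrow> 'a::ab_group_add.
      homotopy r j v g w = (if even (length s) then g (s @ v # u) else - g (s @ v # u))"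
proof -
  have "\<exists>s u. w = s @ u \<and> (\<forall>x\<in>set s. r x < j) \<and> (\<forall>x\<in>set u. j \<le> r x) \<and>
     (\<forall>g :: 'x list \<Rightarrow> 'a.
      homotopy r j v g w = (if even (length s) then g (s @ v # u) else - g (s @ v # u)))"
    using assms
  proof (induction w)
    case Nil
    show ?case by simp
  next
    case (Cons x w)
    have w: "sorted_below r j w" using Cons.prems by (simp add: sorted_below_def)
    show ?case
    proof (cases "r x < j")
      case True
      obtain s u where "w = s @ u" "\<forall>x\<in>set s. r x < j" "\<forall>x\<in>set u. j \<le> r x"
        "\<forall>g :: 'x list \<Rightarrow> 'a.
          homotopy r j v g w = (if even (length s) then g (s @ v # u) else - g (s @ v # u))"
        using Cons.IH[OF w] by blast
      then show ?thesis using True by (intro exI[of _ "x # s"] exI[of _ u]) simp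
    next
      case False
      then have "\<forall>y\<in>set w. j \<le> r y"
        using Cons.prems by (force simp: sorted_below_def)
      then show ?thesis using False by (intro exI[of _ "[]"] exI[of _ "x # w"]) simp
    qed
  qed
  then show thesis using that by blast
qed

lemma sorted_below_0: "sorted_below r 0 w"
  by (induction w) (simp_all add: sorted_below_def)

lemma sorted_below_mono: "sorted_below r k w \<Longrightarrow> j \<le> k \<Longrightarrow> sorted_below r j w"
  unfolding sorted_below_def by (erule sorted_wrt_mono_rel[rotated]) auto

lemma sorted_below_face: "sorted_below r j w \<Longrightarrow> sorted_below r j (take i w @ drop (Suc i) w)"
  unfolding sorted_below_def
proof (induction w arbitrary: i)
  case (Cons x w)
  then show ?case by (cases i) (auto dest: in_set_takeD in_set_dropD)
qed simp

text \<open>An entry of rank \<open>j\<close> is not constrained by sortedness below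
  \<open>j\<close>. If no entry of \<open>u\<close> has rank \<open>j\<close>, all of them have rank
  at least \<open>Suc j\<close>, so sortedness below \<open>Suc j\<close> puts no condition on them
  either.\<close>

lemma sorted_below_insert:
  assumes "sorted_below r j (s @ u)" "\<forall>x\<in>set s. r x < j" "\<forall>x\<in>set u. j \<le> r x" "r v = j"
  shows "sorted_below r j (s @ v # u)"
    and "\<forall>x\<in>set u. r x \<noteq> j \<Longrightarrow> sorted_below r (Suc j) (s @ v # u)"
    and "\<forall>x\<in>set u. r x \<noteq> j \<Longrightarrow> sorted_below r (Suc j) (s @ u)"
  using assms sorted_wrt_mono_rel[of s "\<lambda>x y. r y < j \<longrightarrow> r x < r y" "\<lambda>x y. r y < Suc j \<longrightarrow> r x < r y"]
  by (auto simp: sorted_below_def sorted_wrt_append less_Suc_eq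
     elim!: sorted_wrt_mono_rel[rotated] )


text \<open>If \<open>v\<close> had rank below \<open>j\<close>, its second occurrence would have to
  exceed its first.\<close>

lemma sorted_below_double:
  assumes "sorted_below r j (s @ v # t @ v # u)"
  shows "j \<le> r v"
  using assms by (force simp: sorted_below_def sorted_wrt_append)

text \<open>The two faces that omit one of the adjacent copies of \<open>v\<close> coincide and
  carry opposite signs. Every other face still contains \<open>v\<close> twice, so \<open>g\<close>
  vanishes on it.\<close>

lemma delta_double:
  assumes "\<And>a b c. g (a @ v # b @ v # c) = 0"
  shows "delta g (s @ v # v # u) = 0"
  using assms
proof (induction s arbitrary: g)
  case Nil
  have "(\<lambda>t. g (v # v # t)) = (\<lambda>_. 0)" using Nil[of "[]" "[]"] by auto
  then show ?case using delta_diff[of "\<lambda>_. 0" "\<lambda>_. 0" u] by simp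
next
  case (Cons x s)
  have "g (s @ v # v # u) = 0" using Cons.prems[of s "[]" u] by simp
  moreover have "delta (\<lambda>t. g (x # t)) (s @ v # v # u) = 0"
    using Cons.prems[of "x # _"] by (intro Cons.IH) simp
  ultimately show ?case by simp
qed

lemma delta_apply: "delta g w z = delta (\<lambda>u. g u z) w"
  by (induction w arbitrary: g) auto

lemma homotopy_apply: "homotopy r j v g w z = homotopy r j v (\<lambda>u. g u z) w"
  by (induction w arbitrary: g) auto

lemma delta_zero [simp]: "delta (\<lambda>_. 0) w = 0"
  by (induction w) auto

lemma (in vector_space) delta_in_subspace:
  assumes "subspace S" "\<And>j. j < length w \<Longrightarrow> g (take j w @ drop (Suc j) w) \<in> S"
  shows "delta g w \<in> S"
  using assms(2)
proof (induction w arbitrary: g)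
  case (Cons x w)
  have "g w \<in> S" using Cons.prems[of 0] by simp
  moreover have "delta (\<lambda>u. g (x # u)) w \<in> S"
    using Cons.prems[of "Suc _"] by (intro Cons.IH) auto
  ultimately show ?case using subspace_diff[OF assms(1)] by simp
qed (simp add: subspace_0[OF assms(1)])

section \<open>Sections of the free sheaf\<close>

text \<open>Replaces the support by any finite set containing it, so that several vectors can be
  summed over the same index set.\<close>

lemma free_map_eq_sum:
  assumes "finite X" "\<And>x. x \<notin> X \<Longrightarrow> v x = 0"
  shows "free_map f v y = (\<Sum>x | x \<in> X \<and> f x = y. v x)"
  unfolding free_map_def
  by (rule sum.mono_neutral_left) (use assms in auto)

text \<open>Functoriality: the fibres of the composite are partitioned by the values of
  \<open>h\<close>.\<close>

lemma free_map_push: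
  assumes "finite X"
  shows "free_map f (\<lambda>y. \<Sum>x | x \<in> X \<and> h x = y. v x) = (\<lambda>z. \<Sum>x | x \<in> X \<and> f (h x) = z. v x)"
proof
  fix z
  have "free_map f (\<lambda>y. \<Sum>x | x \<in> X \<and> h x = y. v x) z =
      (\<Sum>y | y \<in> h ` X \<and> f y = z. \<Sum>x | x \<in> X \<and> h x = y. v x)"
    by (rule free_map_eq_sum) (use assms in \<open>auto intro!: sum.neutral\<close>)
  also have "\<dots> = (\<Sum>y | y \<in> h ` X \<and> f y = z. \<Sum>x | x \<in> {x \<in> X. f (h x) = z} \<and> h x = y. v x)"
    by (intro sum.cong) auto
  also have "\<dots> = (\<Sum>x | x \<in> X \<and> f (h x) = z. v x)"
    by (rule sum.group) (use assms in auto)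
  finally show "free_map f (\<lambda>y. \<Sum>x | x \<in> X \<and> h x = y. v x) z = (\<Sum>x | x \<in> X \<and> f (h x) = z. v x)" .
qed

lemma free_map_add:
  assumes "v \<in> free_space X" "w \<in> free_space X"
  shows "free_map f (v + w) = free_map f v + free_map f w"
proof
  fix y
  let ?X = "{x. v x \<noteq> 0} \<union> {x. w x \<noteq> 0}"
  have X: "finite ?X" using assms by (simp add: free_space_def)
  have "free_map f u y = (\<Sum>x | x \<in> ?X \<and> f x = y. u x)" if "u \<in> {v, w, v + w}" for u
    by (rule free_map_eq_sum[OF X]) (use that in auto)
  then show "free_map f (v + w) y = (free_map f v + free_map f w) y"
    by (simp add: sum.distrib del: Un_iff)
qed

lemma free_map_smult:
  assumes "v \<in> free_space X"
  shows "free_map f (\<lambda>x. c * v x) = (\<lambda>y. c * free_map f v y)"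
proof
  fix y
  have X: "finite {x. v x \<noteq> 0}" using assms by (simp add: free_space_def)
  have "free_map f u y = (\<Sum>x | x \<in> {x. v x \<noteq> 0} \<and> f x = y. u x)"
    if "u \<in> {v, \<lambda>x. c * v x}" for u
    by (rule free_map_eq_sum[OF X]) (use that in auto)
  then show "free_map f (\<lambda>x. c * v x) y = c * free_map f v y"
    by (simp add: sum_distrib_left)
qed

lemma free_space_add:
  assumes "v \<in> free_space X" "w \<in> free_space X"
  shows "v + w \<in> free_space X"
proof -
  have "{x. (v + w) x \<noteq> 0} \<subseteq> {x. v x \<noteq> 0} \<union> {x. w x \<noteq> 0}" by auto
  then show ?thesis
    using assms finite_subset[of "{x. (v + w) x \<noteq> 0}" "{x. v x \<noteq> 0} \<union> {x. w x \<noteq> 0}"]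
    unfolding free_space_def by blast
qed

lemma free_space_smult: "v \<in> free_space X \<Longrightarrow> (\<lambda>x. c * v x) \<in> free_space X"
  by (auto simp: free_space_def intro: rev_finite_subset[of "{x. v x \<noteq> 0}"])

abbreviation section_scale :: "'k \<Rightarrow> ('i set \<Rightarrow> ('i \<Rightarrow> 'e) \<Rightarrow> 'k::field) \<Rightarrow> 'i set \<Rightarrow> ('i \<Rightarrow> 'e) \<Rightarrow> 'k" where
  "section_scale \<equiv> (\<lambda>c s \<omega> x. c * s \<omega> x)"

abbreviation cochain_scale :: "'k \<Rightarrow> ('i, 'e, 'k::field) cochain \<Rightarrow> ('i, 'e, 'k) cochain" where
  "cochain_scale \<equiv> (\<lambda>c f w \<omega> x. c * f w \<omega> x)"

interpretation section_space: vector_space "section_scale :: 'k::field \<Rightarrow> ('i set \<Rightarrow> ('i \<Rightarrow> 'e) \<Rightarrow> 'k) \<Rightarrow> _"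
  by unfold_locales (simp_all add: fun_eq_iff distrib_left distrib_right)

interpretation cochain_space: vector_space "cochain_scale :: 'k::field \<Rightarrow> ('i, 'e, 'k) cochain \<Rightarrow> _"
  by unfold_locales (simp_all add: fun_eq_iff distrib_left distrib_right)

lemma subspace_sections:
  fixes E :: "'i \<Rightarrow> 'e set"
  shows "section_space.subspace (sections E W :: ('i set \<Rightarrow> ('i \<Rightarrow> 'e) \<Rightarrow> 'k::field) set)"
proof (rule section_space.subspaceI)
  show "(0 :: 'i set \<Rightarrow> ('i \<Rightarrow> 'e) \<Rightarrow> 'k) \<in> sections E W"
    by (auto simp: sections_def free_space_def free_map_def fun_eq_iff)
next
  fix s t :: "'i set \<Rightarrow> ('i \<Rightarrow> 'e) \<Rightarrow> 'k"
  assume s: "s \<in> sections E W" and t: "t \<in> sections E W"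
  show "s + t \<in> sections E W"
    unfolding sections_def
  proof (intro CollectI conjI ballI impI allI)
    fix \<alpha> \<beta> assume "\<alpha> \<in> W" "\<beta> \<in> W" "\<beta> \<subseteq> \<alpha>"
    then show "free_map (\<lambda>x. restrict x \<beta>) ((s + t) \<alpha>) = (s + t) \<beta>"
      using s t by (simp add: sections_def free_map_add[of _ "PiE \<alpha> E"])
  qed (use s t in \<open>auto simp: sections_def free_space_add fun_eq_iff\<close>)
next
  fix c and s :: "'i set \<Rightarrow> ('i \<Rightarrow> 'e) \<Rightarrow> 'k"
  assume s: "s \<in> sections E W"
  show "(\<lambda>\<omega> x. c * s \<omega> x) \<in> sections E W"
    unfolding sections_def
  proof (intro CollectI conjI ballI impI allI)
    fix \<alpha> \<beta> assume "\<alpha> \<in> W" "\<beta> \<in> W" "\<beta> \<subseteq> \<alpha>"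
    then show "free_map (\<lambda>x. restrict x \<beta>) (\<lambda>x. c * s \<alpha> x) = (\<lambda>x. c * s \<beta> x)"
      using s by (simp add: sections_def free_map_smult[of _ "PiE \<alpha> E"])
  qed (use s in \<open>auto simp: sections_def free_space_smult fun_eq_iff\<close>)
qed

lemma section_restrict_sections:
  assumes "s \<in> sections E W" "V \<subseteq> W"
  shows "section_restrict V s \<in> sections E V"
  using assms by (auto simp: sections_def section_restrict_def subset_iff)

lemma sections_outside: "s \<in> sections E W \<Longrightarrow> \<omega> \<notin> W \<Longrightarrow> s \<omega> x = 0"
  by (simp add: sections_def)

section \<open>Cochains on a set of simplices\<close>

text \<open>\<open>cech_cochains\<close> with an arbitrary set of simplices, so that all
  intermediate complexes of the comparison are treated alike.\<close>

definition cochains_on ::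
    "('i \<Rightarrow> 'e set) \<Rightarrow> 'i set set list set \<Rightarrow> ('i, 'e, 'k::field) cochain set" where
  "cochains_on E S = {f. (\<forall>w\<in>S. f w \<in> sections E (\<Inter>(set w))) \<and> (\<forall>w. w \<notin> S \<longrightarrow> f w = 0)}"

text \<open>\<open>S\<close> is the set of simplices on which the result lives. The source can stay
  implicit, since cochains vanish outside their simplices.\<close>

definition diff_on :: "'i set set list set \<Rightarrow> ('i, 'e, 'k::field) cochain \<Rightarrow> ('i, 'e, 'k) cochain" where
  "diff_on S f = (\<lambda>w. if w \<in> S then delta (\<lambda>u. section_restrict (\<Inter>(set w)) (f u)) w else 0)"

lemma diff_on_apply:
  "diff_on S f w \<omega> x = (if w \<in> S \<and> \<omega> \<in> \<Inter>(set w) then delta (\<lambda>u. f u \<omega> x) w else 0)"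
  by (simp add: diff_on_def delta_apply section_restrict_def del: Inter_iff)

lemma cochains_on_outside:
  assumes "f \<in> cochains_on E S" "w \<notin> S \<or> \<omega> \<notin> \<Inter>(set w)"
  shows "f w \<omega> x = 0"
proof (cases "w \<in> S")
  case True
  then have "f w \<in> sections E (\<Inter>(set w))" "\<omega> \<notin> \<Inter>(set w)"
    using assms by (simp_all add: cochains_on_def del: Inter_iff)
  then show ?thesis by (rule sections_outside)
qed (use assms in \<open>simp add: cochains_on_def\<close>)

lemma subspace_cochains_on:
  fixes E :: "'i \<Rightarrow> 'e set"
  shows "cochain_space.subspace (cochains_on E S :: ('i, 'e, 'k::field) cochain set)"
proof (rule cochain_space.subspaceI)
  show "(0 :: ('i, 'e, 'k) cochain) \<in> cochains_on E S"
    by (simp add: cochains_on_def section_space.subspace_0[OF subspace_sections])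
next
  fix f g :: "('i, 'e, 'k) cochain"
  assume "f \<in> cochains_on E S" "g \<in> cochains_on E S"
  then show "f + g \<in> cochains_on E S"
    by (simp add: cochains_on_def section_space.subspace_add[OF subspace_sections])
next
  fix c and f :: "('i, 'e, 'k) cochain"
  assume "f \<in> cochains_on E S"
  then show "(\<lambda>w \<omega> x. c * f w \<omega> x) \<in> cochains_on E S"
    by (simp add: cochains_on_def zero_fun_def section_space.subspace_scale[OF subspace_sections])
qed

lemma delta_add: "delta (\<lambda>u. f u + g u) w = delta f w + delta g w"
  by (induction w arbitrary: f g) auto

lemma delta_smult: "delta (\<lambda>u. c * f u) w = c * delta f w" for c :: "'a::ring"
  by (induction w arbitrary: f) (simp_all add: right_diff_distrib)

lemma linear_diff_on: "Vector_Spaces.linear cochain_scale cochain_scale (diff_on S)"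
  unfolding Vector_Spaces.linear_iff
  by (intro conjI allI ext cochain_space.vector_space_axioms)
    (simp_all add: diff_on_apply delta_add delta_smult)

definition restrict_cochain :: "'i set set list set \<Rightarrow> ('i, 'e, 'k::field) cochain \<Rightarrow> ('i, 'e, 'k) cochain" where
  "restrict_cochain S f = (\<lambda>w. if w \<in> S then f w else 0)"

lemma linear_restrict_cochain: "Vector_Spaces.linear cochain_scale cochain_scale (restrict_cochain S)"
  unfolding Vector_Spaces.linear_iff
  by (intro conjI allI ext cochain_space.vector_space_axioms) (simp_all add: restrict_cochain_def)

lemma set_face: "set (take i w @ drop (Suc i) w) \<subseteq> set w"
  by (auto dest: in_set_takeD in_set_dropD)

lemma diff_on_cochains_on:
  assumes f: "f \<in> cochains_on E S"
    and faces: "\<And>w i. w \<in> S' \<Longrightarrow> i < length w \<Longrightarrow> take i w @ drop (Suc i) w \<in> S"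
  shows "diff_on S' f \<in> cochains_on E S'"
proof -
  have "delta (\<lambda>u. section_restrict (\<Inter>(set w)) (f u)) w \<in> sections E (\<Inter>(set w))" if w: "w \<in> S'" for w
  proof (rule section_space.delta_in_subspace[OF subspace_sections])
    fix i assume "i < length w"
    then have "take i w @ drop (Suc i) w \<in> S" using faces w by blast
    then show "section_restrict (\<Inter>(set w)) (f (take i w @ drop (Suc i) w)) \<in> sections E (\<Inter>(set w))"
      using f set_face[of i w]
      by (intro section_restrict_sections[of _ _ "\<Inter>(set (take i w @ drop (Suc i) w))"])
        (auto simp: cochains_on_def)
  qed
  then show ?thesis by (simp add: cochains_on_def diff_on_def)
qed

text \<open>At fixed \<omega> and \<open>x\<close> this is \<open>delta_delta\<close>: the faces of
  \<open>w\<close> lie in \<open>S\<close>, and their intersections still contain \<omega>.\<close>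

lemma diff_on_diff_on:
  assumes faces: "\<And>w i. w \<in> S' \<Longrightarrow> i < length w \<Longrightarrow> take i w @ drop (Suc i) w \<in> S"
  shows "diff_on S' (diff_on S f) = 0"
proof (intro ext)
  fix w \<omega> x
  have "delta (\<lambda>u. diff_on S f u \<omega> x) w = delta (delta (\<lambda>u. f u \<omega> x)) w"
    if w: "w \<in> S'" "\<omega> \<in> \<Inter>(set w)"
  proof (rule delta_cong)
    fix i assume i: "i < length w"
    have "\<omega> \<in> \<Inter>(set (take i w @ drop (Suc i) w))" using w(2) set_face[of i w] by blast
    then show "diff_on S f (take i w @ drop (Suc i) w) \<omega> x =
        delta (\<lambda>u. f u \<omega> x) (take i w @ drop (Suc i) w)"
      using faces[OF w(1) i] by (simp add: diff_on_apply del: Inter_iff)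
  qed
  then show "diff_on S' (diff_on S f) w \<omega> x = 0 w \<omega> x"
    by (simp add: diff_on_apply[of S'] delta_delta del: Inter_iff)
qed

text \<open>The intersection of \<open>w\<close> has a greatest member \<open>\<gamma> w\<close>, so
  a section over it is determined by its value there, which may be any vector of the free space.
  \<open>T\<close> rebuilds a cochain from these values by pushing them down, and is an isomorphism
  from the functions supported on \<open>?X\<close>.\<close>

lemma
  fixes E :: "'i \<Rightarrow> 'e set" and \<gamma> :: "'i set set list \<Rightarrow> 'i set"
  assumes fin: "finite S" and top: "\<And>w. w \<in> S \<Longrightarrow> \<gamma> w \<in> \<Inter>(set w)"
    and below: "\<And>w \<omega>. w \<in> S \<Longrightarrow> \<omega> \<in> \<Inter>(set w) \<Longrightarrow> \<omega> \<subseteq> \<gamma> w"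
    and finE: "\<And>w. w \<in> S \<Longrightarrow> finite (PiE (\<gamma> w) E)"
  shows sfin_cochains_on:
      "sfin cochain_scale (cochains_on E S :: ('i, 'e, 'k::field) cochain set)"
    and sdim_cochains_on:
      "sdim cochain_scale (cochains_on E S :: ('i, 'e, 'k) cochain set) = (\<Sum>w\<in>S. card (PiE (\<gamma> w) E))"
proof -
  let ?X = "Sigma S (\<lambda>w. PiE (\<gamma> w) E)"
  let ?F = "{g :: _ \<Rightarrow> 'k. \<forall>z. z \<notin> ?X \<longrightarrow> g z = 0}"
  define T where "T g = (\<lambda>w \<omega> y. if w \<in> S \<and> \<omega> \<in> \<Inter>(set w)
     then \<Sum>x | x \<in> PiE (\<gamma> w) E \<and> restrict x \<omega> = y. g (w, x) else 0)"
    for g :: "'i set set list \<times> ('i \<Rightarrow> 'e) \<Rightarrow> 'k"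
  have finX: "finite ?X" using fin finE by auto
  have card: "card ?X = (\<Sum>w\<in>S. card (PiE (\<gamma> w) E))" using fin finE by (simp add: card_SigmaI)
  interpret F: vector_space "\<lambda>c (f :: 'i set set list \<times> ('i \<Rightarrow> 'e) \<Rightarrow> 'k) x. c * f x"
    by (rule vector_space_fun)
  have sub: "F.subspace ?F" unfolding F.subspace_def by auto
  have lin: "Vector_Spaces.linear (\<lambda>c f x. c * f x) cochain_scale T"
    unfolding Vector_Spaces.linear_iff
    by (rule conjI[OF F.vector_space_axioms conjI[OF cochain_space.vector_space_axioms]],
        intro conjI allI ext) (simp_all add: T_def sum.distrib sum_distrib_left)
  have T_top: "T g w (\<gamma> w) y = g (w, y)" if "w \<in> S" "g \<in> ?F" for g w y
  proof -
    \<comment> \<open>Elements of \<open>PiE (\<gamma> w) E\<close> are extensional, so restriction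
      to \<open>\<gamma> w\<close> fixes them.\<close>
    have "{x. x \<in> PiE (\<gamma> w) E \<and> restrict x (\<gamma> w) = y} = (if y \<in> PiE (\<gamma> w) E then {y} else {})"
      by (auto simp: PiE_restrict)
    then show ?thesis using that top by (auto simp: T_def)
  qed
  have inj: "g = 0" if g: "g \<in> ?F" and 0: "T g = 0" for g
  proof (intro ext)
    fix z
    show "g z = 0 z"
      using g T_top[OF _ g, of "fst z" "snd z"] 0 by (cases z; cases "fst z \<in> S") auto
  qed
  have "T ` ?F = cochains_on E S"
  proof (intro equalityI subsetI)
    fix f assume "f \<in> T ` ?F"
    then obtain g where g: "g \<in> ?F" "f = T g" by auto
    have "f w \<in> sections E (\<Inter>(set w))" if w: "w \<in> S" for w
      unfolding sections_def
    proof (intro CollectI conjI ballI allI impI)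
      fix \<omega> assume \<omega>: "\<omega> \<in> \<Inter>(set w)"
      have *: "y \<in> (\<lambda>x. restrict x \<omega>) ` PiE (\<gamma> w) E" if "f w \<omega> y \<noteq> 0" for y
        using that g(2) w \<omega> by (auto simp: T_def elim!: sum.not_neutral_contains_not_neutral)
      then have "{y. f w \<omega> y \<noteq> 0} \<subseteq> (\<lambda>x. restrict x \<omega>) ` PiE (\<gamma> w) E" by blast
      moreover have "(\<lambda>x. restrict x \<omega>) ` PiE (\<gamma> w) E \<subseteq> PiE \<omega> E"
        using below[OF w \<omega>] by (auto simp: PiE_iff)
      ultimately show "f w \<omega> \<in> free_space (PiE \<omega> E)"
        using finE[OF w] unfolding free_space_def by (blast intro: finite_subset)
    next
      fix \<omega> assume "\<omega> \<notin> \<Inter>(set w)"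
      then show "f w \<omega> = (\<lambda>_. 0)" using g(2) by (simp add: T_def del: Inter_iff)
    next
      fix \<alpha> \<beta> assume \<alpha>: "\<alpha> \<in> \<Inter>(set w)" and \<beta>: "\<beta> \<in> \<Inter>(set w)" and "\<beta> \<subseteq> \<alpha>"
      then have r: "restrict (restrict x \<alpha>) \<beta> = restrict x \<beta>" for x :: "'i \<Rightarrow> 'e"
        by (simp add: Int_absorb1)
      have "T g w \<omega> = (\<lambda>y. \<Sum>x | x \<in> PiE (\<gamma> w) E \<and> restrict x \<omega> = y. g (w, x))" if "\<omega> \<in> \<Inter>(set w)" for \<omega>
        using w that by (auto simp: T_def)
      \<comment> \<open>Both values are pushed down from \<open>\<gamma> w\<close>, so compatibility
        is functoriality.\<close>
      then show "free_map (\<lambda>x. restrict x \<beta>) (f w \<alpha>) = f w \<beta>"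
        using \<alpha> \<beta> free_map_push[OF finE[OF w], where f = "\<lambda>x. restrict x \<beta>" and h = "\<lambda>x. restrict x \<alpha>"] g(2)
        by (simp only: r)
    qed
    moreover have "f w = 0" if "w \<notin> S" for w
      using that g(2) by (simp add: T_def zero_fun_def)
    ultimately show "f \<in> cochains_on E S" unfolding cochains_on_def by blast
  next
    fix f :: "('i, 'e, 'k) cochain" assume f: "f \<in> cochains_on E S"
    \<comment> \<open>The inverse of \<open>T\<close>: evaluation at the greatest member of each
      intersection.\<close>
    define g where "g z = f (fst z) (\<gamma> (fst z)) (snd z)" for z
    have fs: "f w (\<gamma> w) \<in> free_space (PiE (\<gamma> w) E)" if "w \<in> S" for w
      using f top[OF that] that by (auto simp: cochains_on_def sections_def)
    have gF: "g \<in> ?F"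
    proof (intro CollectI allI impI)
      fix z assume "z \<notin> ?X"
      then show "g z = 0"
        using fs[of "fst z"] f by (cases z; cases "fst z \<in> S")
          (auto simp: g_def free_space_def cochains_on_def)
    qed
    have "T g w \<omega> y = f w \<omega> y" for w \<omega> y
    proof (cases "w \<in> S \<and> \<omega> \<in> \<Inter>(set w)")
      case True
      then have "f w \<omega> y = free_map (\<lambda>x. restrict x \<omega>) (f w (\<gamma> w)) y"
        using f top[of w] below[of w \<omega>] by (simp add: cochains_on_def sections_def)
      also have "\<dots> = (\<Sum>x | x \<in> PiE (\<gamma> w) E \<and> restrict x \<omega> = y. f w (\<gamma> w) x)"
        by (rule free_map_eq_sum) (use True finE fs[of w] in \<open>auto simp: free_space_def\<close>)
      finally show ?thesis using True by (simp add: T_def g_def)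
    next
      case False
      then show ?thesis using cochains_on_outside[OF f, of w \<omega> y] by (auto simp: T_def)
    qed
    then have "f = T g" by (simp add: fun_eq_iff)
    then show "f \<in> T ` ?F" using gF by blast
  qed
  then show "sfin cochain_scale (cochains_on E S :: ('i, 'e, 'k) cochain set)"
    and "sdim cochain_scale (cochains_on E S :: ('i, 'e, 'k) cochain set) = (\<Sum>w\<in>S. card (PiE (\<gamma> w) E))"
    using sfin_image[OF lin sub sfin_supported[OF finX]]
      sdim_inj_image[OF lin sub sfin_supported[OF finX] inj] sdim_supported[OF finX] card
    by simp_all
qed

section \<open>Comparison with strictly increasing sequences\<close>

locale finite_hypergraph =
  fixes I :: "'i set" and A :: "'i set set" and E :: "'i \<Rightarrow> 'e set"
  assumes hypergraph: "hypergraph I A" and finite_A: "finite A"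
    and weak_intersection: "weak_intersection_property A"
    and finite_E: "\<And>i. i \<in> I \<Longrightarrow> finite (E i)"
begin

section \<open>Intersections of members of the covering\<close>

lemma finite_prod: "\<alpha> \<in> A \<Longrightarrow> finite (PiE \<alpha> E)"
  using hypergraph finite_E by (auto simp: hypergraph_def intro!: finite_PiE)

text \<open>The weak intersection property says nothing about disjoint \<alpha> and \<beta>. In that
  case a common member of the two open sets can only be the empty set, which thus belongs to
  \<open>A\<close>.\<close>

lemma basic_open_Int:
  assumes "\<alpha> \<in> A" "\<beta> \<in> A" "basic_open A \<alpha> \<inter> basic_open A \<beta> \<noteq> {}"
  shows "\<alpha> \<inter> \<beta> \<in> A" "basic_open A \<alpha> \<inter> basic_open A \<beta> = basic_open A (\<alpha> \<inter> \<beta>)"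
proof -
  show "\<alpha> \<inter> \<beta> \<in> A"
  proof (cases "\<alpha> \<inter> \<beta> = {}")
    case True
    obtain \<delta> where "\<delta> \<in> A" "\<delta> \<subseteq> \<alpha>" "\<delta> \<subseteq> \<beta>" using assms(3) by (auto simp: basic_open_def)
    then have "\<delta> = \<alpha> \<inter> \<beta>" using True by blast
    then show ?thesis using \<open>\<delta> \<in> A\<close> by simp
  qed (use weak_intersection assms in \<open>simp add: weak_intersection_property_def\<close>)
qed (auto simp: basic_open_def)

lemma Inter_cover:
  assumes "finite S" "S \<noteq> {}" "S \<subseteq> basic_cover A" "\<Inter>S \<noteq> {}"
  shows "\<exists>\<gamma>\<in>A. \<Inter>S = basic_open A \<gamma>"
  using assms
proof (induction S rule: finite_ne_induct)
  case (singleton U)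
  then show ?case by (auto simp: basic_cover_def)
next
  case (insert U S)
  have "S \<subseteq> basic_cover A" "\<Inter>S \<noteq> {}" using insert.prems by auto
  then obtain \<gamma> where \<gamma>: "\<gamma> \<in> A" "\<Inter>S = basic_open A \<gamma>" using insert.IH by blast
  obtain \<alpha> where \<alpha>: "\<alpha> \<in> A" "U = basic_open A \<alpha>" using insert.prems by (auto simp: basic_cover_def)
  have eq: "\<Inter>(insert U S) = basic_open A \<alpha> \<inter> basic_open A \<gamma>" using \<alpha> \<gamma> by simp
  show ?case using basic_open_Int[OF \<alpha>(1) \<gamma>(1)] insert.prems(2) unfolding eq by blast
qed

text \<open>A basic open set has its index as greatest member, and hence as union. So
  \<open>\<Union>(\<Inter>S)\<close> is an explicit term for the index of the intersection, used
  from here on.\<close>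

lemma Union_Inter_cover:
  assumes "finite S" "S \<noteq> {}" "S \<subseteq> basic_cover A" "\<Inter>S \<noteq> {}"
  shows "\<Union>(\<Inter>S) \<in> A" "\<Inter>S = basic_open A (\<Union>(\<Inter>S))"
proof -
  obtain \<gamma> where \<gamma>: "\<gamma> \<in> A" "\<Inter>S = basic_open A \<gamma>" using Inter_cover[OF assms] by blast
  have "\<Union>(\<Inter>S) = \<gamma>" unfolding \<gamma>(2) using \<gamma>(1) by (auto simp: basic_open_def)
  then show "\<Union>(\<Inter>S) \<in> A" "\<Inter>S = basic_open A (\<Union>(\<Inter>S))" using \<gamma> by simp_all
qed

lemma finite_cover: "finite (basic_cover A)"
  using finite_A by (simp add: basic_cover_def)

text \<open>These simplices interpolate between all sequences (\<open>j = 0\<close>) and the strictly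
  increasing ones (\<open>j\<close> large).\<close>

definition stage :: "('i set set \<Rightarrow> nat) \<Rightarrow> nat \<Rightarrow> nat \<Rightarrow> 'i set set list set" where
  "stage r j k = {w \<in> cech_simplices (basic_cover A) k. sorted_below r j w}"

lemma stage_0: "stage r 0 k = cech_simplices (basic_cover A) k"
  by (simp add: stage_def sorted_below_0)

lemma stage_Suc_subset: "stage r (Suc j) k \<subseteq> stage r j k"
  by (auto simp: stage_def intro: sorted_below_mono)

lemma finite_stage: "finite (stage r j k)"
  by (rule finite_subset[OF _ finite_lists_length_eq[OF finite_cover, of "Suc k"]])
    (auto simp: stage_def cech_simplices_def)

lemma stage_face:
  assumes "w \<in> stage r j (Suc k)" "i < length w"
  shows "take i w @ drop (Suc i) w \<in> stage r j k"
proof -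
  let ?u = "take i w @ drop (Suc i) w"
  have w: "length w = Suc (Suc k)" "set w \<subseteq> basic_cover A" "\<Inter>(set w) \<noteq> {}" "sorted_below r j w"
    using assms(1) by (simp_all add: stage_def cech_simplices_def)
  have "\<Inter>(set w) \<subseteq> \<Inter>(set ?u)" using set_face[of i w] by (rule Inter_anti_mono)
  then have "\<Inter>(set ?u) \<noteq> {}" using w(3) by blast
  moreover have "length ?u = Suc k" using w(1) assms(2) by simp
  moreover have "set ?u \<subseteq> basic_cover A" using w(2) set_face[of i w] by blast
  moreover have "sorted_below r j ?u" by (rule sorted_below_face[OF w(4)])
  ultimately show ?thesis unfolding stage_def cech_simplices_def by blast
qed

lemma stage_top:
  assumes "w \<in> stage r j k"
  shows "\<Union>(\<Inter>(set w)) \<in> A" "\<Inter>(set w) = basic_open A (\<Union>(\<Inter>(set w)))"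
  using assms Union_Inter_cover[of "set w"] by (force simp: stage_def cech_simplices_def)+

lemma
  shows sfin_stage:
      "sfin cochain_scale (cochains_on E (stage r j k) :: ('i, 'e, 'k::field) cochain set)"
    and sdim_stage:
      "sdim cochain_scale (cochains_on E (stage r j k) :: ('i, 'e, 'k) cochain set) =
        (\<Sum>w\<in>stage r j k. card (PiE (\<Union>(\<Inter>(set w))) E))"
proof -
  have t: "\<Union>(\<Inter>(set w)) \<in> \<Inter>(set w)" if "w \<in> stage r j k" for w
    using stage_top[OF that] by (metis (mono_tags, lifting) basic_open_def mem_Collect_eq subset_refl)
  have b: "\<omega> \<subseteq> \<Union>(\<Inter>(set w))" if "w \<in> stage r j k" "\<omega> \<in> \<Inter>(set w)" for w \<omega>
    by (rule Sup_upper[OF that(2)])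
  have fin: "finite (PiE (\<Union>(\<Inter>(set w))) E)" if "w \<in> stage r j k" for w
    by (rule finite_prod[OF stage_top(1)[OF that]])
  show "sfin cochain_scale (cochains_on E (stage r j k) :: ('i, 'e, 'k) cochain set)"
    by (rule sfin_cochains_on[OF finite_stage t b fin])
  show "sdim cochain_scale (cochains_on E (stage r j k) :: ('i, 'e, 'k) cochain set) =
      (\<Sum>w\<in>stage r j k. card (PiE (\<Union>(\<Inter>(set w))) E))"
    by (rule sdim_cochains_on[OF finite_stage t b fin])
qed

lemma cochain_complex_stage:
  "cochain_complex (cochain_scale :: 'k::field \<Rightarrow> ('i, 'e, 'k) cochain \<Rightarrow> _)
    (\<lambda>k. cochains_on E (stage r j k)) (\<lambda>k. diff_on (stage r j (Suc k)))"
proof (intro cochain_complex.intro cochain_complex_axioms.intro)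
  show "vector_space (cochain_scale :: 'k \<Rightarrow> ('i, 'e, 'k) cochain \<Rightarrow> _)"
    by (rule cochain_space.vector_space_axioms)
  fix k and x :: "('i, 'e, 'k) cochain"
  show "cochain_space.subspace (cochains_on E (stage r j k) :: ('i, 'e, 'k) cochain set)"
    by (rule subspace_cochains_on)
  show "Vector_Spaces.linear cochain_scale (cochain_scale :: 'k \<Rightarrow> ('i, 'e, 'k) cochain \<Rightarrow> _)
      (diff_on (stage r j (Suc k)))"
    by (rule linear_diff_on)
  show "sfin cochain_scale (cochains_on E (stage r j k) :: ('i, 'e, 'k) cochain set)"
    by (rule sfin_stage)
  assume "x \<in> cochains_on E (stage r j k)"
  then show "diff_on (stage r j (Suc k)) x \<in> cochains_on E (stage r j (Suc k))"
    by (rule diff_on_cochains_on) (rule stage_face)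
  show "diff_on (stage r j (Suc (Suc k))) (diff_on (stage r j (Suc k)) x) = 0"
    by (rule diff_on_diff_on) (rule stage_face)
qed

section \<open>Comparison of the stages \<open>j\<close> and \<open>Suc j\<close>\<close>

context
  fixes r :: "'i set set \<Rightarrow> nat" and j :: nat and v :: "'i set set"
  assumes inj: "inj_on r (basic_cover A)" and v: "v \<in> basic_cover A" "r v = j"
begin

text \<open>As \<open>v\<close> already occurs in \<open>u\<close>, the intersection is unchanged
  and remains non-empty.\<close>

lemma insert_stage:
  assumes "s @ u \<in> stage r j k" "\<forall>x\<in>set s. r x < j" "\<forall>x\<in>set u. j \<le> r x" "v \<in> set u"
  shows "s @ v # u \<in> stage r j (Suc k)" "set (s @ v # u) = set (s @ u)"
proof -
  show eq: "set (s @ v # u) = set (s @ u)" using assms(4) by auto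
  show "s @ v # u \<in> stage r j (Suc k)"
    using assms(1) sorted_below_insert(1)[OF _ assms(2,3) v(2)]
    unfolding stage_def cech_simplices_def mem_Collect_eq eq by simp
qed

text \<open>By injectivity of \<open>r\<close> only \<open>v\<close> has rank \<open>j\<close>, so
  the entries of \<open>u\<close> all have rank above \<open>j\<close>.\<close>

lemma insert_sorted_below:
  assumes "sorted_below r j (s @ u)" "\<forall>x\<in>set s. r x < j" "\<forall>x\<in>set u. j \<le> r x"
    "set u \<subseteq> basic_cover A" "v \<notin> set u"
  shows "sorted_below r (Suc j) (s @ v # u)" "sorted_below r (Suc j) (s @ u)"
proof -
  have "\<forall>x\<in>set u. r x \<noteq> j" using assms(4,5) inj v unfolding inj_on_def by blast
  then show "sorted_below r (Suc j) (s @ v # u)" "sorted_below r (Suc j) (s @ u)"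
    using sorted_below_insert(2,3)[OF assms(1-3) v(2)] by blast+
qed

text \<open>A cocycle that vanishes at stage \<open>Suc j\<close> is a coboundary, with a primitive
  given by the homotopy. Where \<open>v\<close> occurs in \<open>u\<close>, its insertion keeps the
  intersection. Elsewhere it gives a list sorted below \<open>Suc j\<close>, on which
  \<open>f\<close> is zero. The hypothesis \<open>f0\<close> includes lists that are not simplices,
  because inserting a new \<open>v\<close> may make the intersection empty.\<close>

lemma
  fixes f :: "('i, 'e, 'k::field) cochain"
  assumes f: "f \<in> cochains_on E (stage r j (Suc k))"
    and f0: "\<And>w. sorted_below r (Suc j) w \<Longrightarrow> f w = 0"
    and df: "diff_on (stage r j (Suc (Suc k))) f = 0"
  defines "y \<equiv> restrict_cochain (stage r j k) (homotopy r j v f)"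
  shows homotopy_cochains_on: "y \<in> cochains_on E (stage r j k)"
    and diff_on_homotopy: "diff_on (stage r j (Suc k)) y = f"
proof -
  show "y \<in> cochains_on E (stage r j k)"
    unfolding cochains_on_def
  proof (intro CollectI conjI ballI allI impI)
    fix w assume w: "w \<in> stage r j k"
    then have sw: "sorted_below r j w" "set w \<subseteq> basic_cover A"
      by (simp_all add: stage_def cech_simplices_def)
    obtain s u where su: "w = s @ u" "\<forall>x\<in>set s. r x < j" "\<forall>x\<in>set u. j \<le> r x"
      and h: "\<And>g :: ('i, 'e, 'k) cochain.
        homotopy r j v g w = (if even (length s) then g (s @ v # u) else - g (s @ v # u))"
      using homotopy_eq_insert[OF sw(1)] by metis
    have "f (s @ v # u) \<in> sections E (\<Inter>(set w))"
    proof (cases "v \<in> set u")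
      case True
      have "s @ v # u \<in> stage r j (Suc k)" "set (s @ v # u) = set w"
        using insert_stage[of s u k] w su True by blast+
      then show ?thesis using f unfolding cochains_on_def by (metis (mono_tags, lifting) mem_Collect_eq)
    next
      case False
      then have "f (s @ v # u) = 0"
        using f0 insert_sorted_below(1)[of s u] sw su by simp
      then show ?thesis using section_space.subspace_0[OF subspace_sections] by simp
    qed
    then show "y w \<in> sections E (\<Inter>(set w))"
      using w h[of f] by (simp add: y_def restrict_cochain_def section_space.subspace_neg[OF subspace_sections])
  qed (simp add: y_def restrict_cochain_def)
  show "diff_on (stage r j (Suc k)) y = f"
  proof (intro ext)
    fix w \<omega> x
    define g where "g u = f u \<omega> x" for u
    show "diff_on (stage r j (Suc k)) y w \<omega> x = f w \<omega> x"
    proof (cases "w \<in> stage r j (Suc k) \<and> \<omega> \<in> \<Inter>(set w)")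
      case False
      then have "diff_on (stage r j (Suc k)) y w \<omega> x = 0"
        by (simp only: diff_on_apply if_False)
      moreover have "f w \<omega> x = 0" by (rule cochains_on_outside[OF f]) (use False in blast)
      ultimately show ?thesis by simp
    next
      case True
      then have w: "w \<in> stage r j (Suc k)" and \<omega>: "\<omega> \<in> \<Inter>(set w)" by blast+
      have sw: "sorted_below r j w" "set w \<subseteq> basic_cover A"
        using w by (simp_all add: stage_def cech_simplices_def)
      have "diff_on (stage r j (Suc k)) y w \<omega> x = delta (\<lambda>u. y u \<omega> x) w"
        using True by (simp only: diff_on_apply simp_thms if_True)
      \<comment> \<open>\<open>y\<close> is cut off outside stage \<open>j\<close>, but all faces of
        \<open>w\<close> belong to that stage.\<close>
      also have "\<dots> = delta (homotopy r j v g) w"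
        by (rule delta_cong)
          (use stage_face[OF w] in \<open>simp add: y_def restrict_cochain_def homotopy_apply g_def[abs_def]\<close>)
      also have "\<dots> = g w"
      proof -
        obtain s u where su: "w = s @ u" "\<forall>x\<in>set s. r x < j" "\<forall>x\<in>set u. j \<le> r x"
          and h: "\<And>g :: _ \<Rightarrow> 'k.
            homotopy r j v g w = (if even (length s) then g (s @ v # u) else - g (s @ v # u))"
          using homotopy_eq_insert[OF sw(1)] by metis
        show ?thesis
        proof (cases "v \<in> set u")
          case True
          \<comment> \<open>The longer list is a simplex whose intersection contains \<omega>, so
            the cocycle condition holds there and removes the second term of
            \<open>delta_homotopy\<close>.\<close>
          have i: "s @ v # u \<in> stage r j (Suc (Suc k))" "\<omega> \<in> \<Inter>(set (s @ v # u))"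
            using insert_stage[of s u "Suc k"] w su True \<omega> by simp_all
          have "delta g (s @ v # u) = diff_on (stage r j (Suc (Suc k))) f (s @ v # u) \<omega> x"
            using i by (simp only: diff_on_apply g_def[abs_def] if_True simp_thms)
          then have d0: "delta g (s @ v # u) = 0" unfolding df by simp
          have "homotopy r j v (delta g) w = 0" unfolding h d0 by simp
          then show ?thesis using delta_homotopy[OF sw(1), where g = g and v = v] by simp
        next
          case False
          \<comment> \<open>Now \<open>v\<close> occurs neither in \<open>w\<close> nor in its
            faces. Inserting it into a face gives a list sorted below \<open>Suc j\<close>, and
            \<open>w\<close> itself is such a list, so both sides are zero.\<close>
          then have vw: "v \<notin> set w" using su v(2) by auto
          have "homotopy r j v g (take i w @ drop (Suc i) w) = 0" for i
          proof -
            let ?w = "take i w @ drop (Suc i) w"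
            have sw': "sorted_below r j ?w" by (rule sorted_below_face[OF sw(1)])
            obtain s' u' where su': "?w = s' @ u'" "\<forall>x\<in>set s'. r x < j" "\<forall>x\<in>set u'. j \<le> r x"
              and h': "\<And>g :: _ \<Rightarrow> 'k.
                homotopy r j v g ?w = (if even (length s') then g (s' @ v # u') else - g (s' @ v # u'))"
              using homotopy_eq_insert[OF sw'] by metis
            have "set u' \<subseteq> set ?w" unfolding su'(1) by simp
            then have "set u' \<subseteq> set w" using set_face[of i w] by blast
            then have "sorted_below r (Suc j) (s' @ v # u')"
              using insert_sorted_below(1)[of s' u'] sw' sw(2) su' vw by auto
            then have "g (s' @ v # u') = 0" using f0 by (simp add: g_def)
            then show ?thesis using h'[of g] by simp
          qed
          then have "delta (homotopy r j v g) w = delta (\<lambda>_. 0) w" by (intro delta_cong) simp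
          moreover have "g w = 0"
            using f0 insert_sorted_below(2)[of s u] sw su False by (simp add: g_def)
          ultimately show ?thesis by simp
        qed
      qed
      finally show ?thesis by (simp add: g_def)
    qed
  qed
qed

lemma cochains_on_mono:
  assumes "f \<in> cochains_on E S" "S \<subseteq> T"
  shows "f \<in> cochains_on E T"
proof -
  have "f w \<in> sections E (\<Inter>(set w))" for w
    using assms(1)
    by (cases "w \<in> S") (simp_all add: cochains_on_def section_space.subspace_0[OF subspace_sections])
  then show ?thesis using assms by (auto simp: cochains_on_def simp del: Inter_iff)
qed

text \<open>Extended by zero, \<open>x\<close> need not be a cocycle at stage \<open>j\<close>, but
  its coboundary vanishes at stage \<open>Suc j\<close> and so equals the coboundary of some
  \<open>y\<close> given by the homotopy. This \<open>y\<close> vanishes at stage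
  \<open>Suc j\<close>, so \<open>x - y\<close> is a cocycle that restricts to
  \<open>x\<close>.\<close>

lemma lift_cocycle:
  fixes x :: "('i, 'e, 'k::field) cochain"
  assumes x: "x \<in> cochains_on E (stage r (Suc j) k)"
    and dx: "diff_on (stage r (Suc j) (Suc k)) x = 0"
  shows "\<exists>z\<in>cochains_on E (stage r j k). diff_on (stage r j (Suc k)) z = 0 \<and>
    restrict_cochain (stage r (Suc j) k) z = x"
proof -
  interpret C: cochain_complex "cochain_scale :: 'k \<Rightarrow> ('i, 'e, 'k) cochain \<Rightarrow> _"
    "\<lambda>k. cochains_on E (stage r j k)" "\<lambda>k. diff_on (stage r j (Suc k))"
    by (rule cochain_complex_stage)
  interpret d: Vector_Spaces.linear cochain_scale "cochain_scale :: 'k \<Rightarrow> ('i, 'e, 'k) cochain \<Rightarrow> _"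
    "diff_on (stage r j (Suc k))"
    by (rule linear_diff_on)
  let ?f = "diff_on (stage r j (Suc k)) x"
  have xj: "x \<in> cochains_on E (stage r j k)" by (rule cochains_on_mono[OF x stage_Suc_subset])
  have f: "?f \<in> cochains_on E (stage r j (Suc k))" and df: "diff_on (stage r j (Suc (Suc k))) ?f = 0"
    using C.d_C[OF xj] C.d_d[OF xj] by simp_all
  have f0: "?f w = 0" if "sorted_below r (Suc j) w" for w
  proof (cases "w \<in> stage r j (Suc k)")
    case True
    then have "w \<in> stage r (Suc j) (Suc k)" using that by (simp add: stage_def)
    then have "?f w = diff_on (stage r (Suc j) (Suc k)) x w" using True by (simp add: diff_on_def)
    then show ?thesis by (simp add: dx)
  qed (simp add: diff_on_def)
  define y where "y = restrict_cochain (stage r j k) (homotopy r j v ?f)"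
  have y: "y \<in> cochains_on E (stage r j k)" "diff_on (stage r j (Suc k)) y = ?f"
    using homotopy_cochains_on[OF f f0 df] diff_on_homotopy[OF f f0 df] by (simp_all add: y_def)
  have y0: "y w = 0" if w: "w \<in> stage r (Suc j) k" for w
  proof -
    have wj: "w \<in> stage r j k" using w stage_Suc_subset by blast
    have sw: "sorted_below r j w" "set w \<subseteq> basic_cover A" "sorted_below r (Suc j) w"
      using w wj by (simp_all add: stage_def cech_simplices_def)
    obtain s u where su: "w = s @ u" "\<forall>x\<in>set s. r x < j" "\<forall>x\<in>set u. j \<le> r x"
      and h: "\<And>g :: ('i, 'e, 'k) cochain.
        homotopy r j v g w = (if even (length s) then g (s @ v # u) else - g (s @ v # u))"
      using homotopy_eq_insert[OF sw(1)] by metis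
    have "?f (s @ v # u) = 0"
    proof (cases "v \<in> set u")
      case False
      then show ?thesis using f0 insert_sorted_below(1)[of s u] sw su by simp
    next
      case True
      then obtain a b where ab: "u = a @ v # b" by (auto simp: in_set_conv_decomp)
      \<comment> \<open>\<open>v\<close> has rank \<open>j\<close>, so it is subject to the ordering
        of stage \<open>Suc j\<close>, while all entries of \<open>u\<close> have rank at least
        \<open>j\<close>. Hence \<open>v\<close> must be the first of them.\<close>
      have "a = []"
      proof (cases a)
        case (Cons c a')
        then show ?thesis using sw(3) su(3) v(2) ab unfolding su(1) sorted_below_def
          by (auto simp: sorted_wrt_append)
      qed simp
      then have u: "u = v # b" using ab by simp
      \<comment> \<open>The sequences of stage \<open>Suc j\<close> contain \<open>v\<close> at most
        once. This is what allows \<open>delta_double\<close> to be applied to the doubled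
        \<open>v\<close>.\<close>
      have x0: "x (a @ v # b @ v # c) \<omega> z = 0" for a b c \<omega> z
      proof -
        have "a @ v # b @ v # c \<notin> stage r (Suc j) k"
          using sorted_below_double[of r "Suc j" a v b c] v(2) by (auto simp: stage_def)
        then show ?thesis using cochains_on_outside[OF x] by blast
      qed
      have "?f (s @ v # v # b) \<omega> z = 0" for \<omega> z
        by (simp add: diff_on_apply delta_double[of "\<lambda>u. x u \<omega> z", OF x0] del: Inter_iff)
      then show ?thesis by (simp add: u fun_eq_iff)
    qed
    then show ?thesis using h[of ?f] wj by (simp add: y_def restrict_cochain_def)
  qed
  have "x - y \<in> cochains_on E (stage r j k)"
    by (rule cochain_space.subspace_diff[OF subspace_cochains_on xj y(1)])
  moreover have "diff_on (stage r j (Suc k)) (x - y) = 0" by (simp add: d.diff y(2))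
  moreover have "restrict_cochain (stage r (Suc j) k) (x - y) = x"
  proof
    fix w
    show "restrict_cochain (stage r (Suc j) k) (x - y) w = x w"
      using x y0[of w] by (cases "w \<in> stage r (Suc j) k") (simp_all add: restrict_cochain_def cochains_on_def)
  qed
  ultimately show ?thesis by blast
qed

text \<open>An instance of \<open>betti_eq\<close>, the projection being the restriction of cochains
  to the smaller stage.\<close>

lemma betti_stage_Suc:
  "cochain_complex.betti (cochain_scale :: 'k::field \<Rightarrow> ('i, 'e, 'k) cochain \<Rightarrow> _)
      (\<lambda>k. cochains_on E (stage r j k)) (\<lambda>k. diff_on (stage r j (Suc k))) k =
    cochain_complex.betti (cochain_scale :: 'k \<Rightarrow> ('i, 'e, 'k) cochain \<Rightarrow> _)
      (\<lambda>k. cochains_on E (stage r (Suc j) k)) (\<lambda>k. diff_on (stage r (Suc j) (Suc k))) k"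
proof (rule betti_eq[where p = "\<lambda>k. restrict_cochain (stage r (Suc j) k)"])
  fix k
  let ?S = "stage r j" and ?S' = "stage r (Suc j)"
  show "restrict_cochain (?S' k) ` cochains_on E (?S k) = (cochains_on E (?S' k) :: ('i, 'e, 'k) cochain set)"
  proof (intro equalityI subsetI)
    fix x :: "('i, 'e, 'k) cochain" assume "x \<in> restrict_cochain (?S' k) ` cochains_on E (?S k)"
    then show "x \<in> cochains_on E (?S' k)"
      using stage_Suc_subset[of r j k] by (auto simp: cochains_on_def restrict_cochain_def)
  next
    fix x :: "('i, 'e, 'k) cochain" assume x: "x \<in> cochains_on E (?S' k)"
    then have "x = restrict_cochain (?S' k) x" by (auto simp: cochains_on_def restrict_cochain_def)
    then show "x \<in> restrict_cochain (?S' k) ` cochains_on E (?S k)"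
      using cochains_on_mono[OF x stage_Suc_subset] by blast
  qed
  fix x :: "('i, 'e, 'k) cochain"
  show "restrict_cochain (?S' (Suc k)) (diff_on (?S (Suc k)) x) =
      diff_on (?S' (Suc k)) (restrict_cochain (?S' k) x)"
  proof
    fix w
    have "delta (\<lambda>u. section_restrict (\<Inter>(set w)) (x u)) w =
        delta (\<lambda>u. section_restrict (\<Inter>(set w)) (restrict_cochain (?S' k) x u)) w"
      if "w \<in> ?S' (Suc k)"
      by (rule delta_cong) (use stage_face[OF that] in \<open>simp add: restrict_cochain_def\<close>)
    then show "restrict_cochain (?S' (Suc k)) (diff_on (?S (Suc k)) x) w =
        diff_on (?S' (Suc k)) (restrict_cochain (?S' k) x) w"
      using stage_Suc_subset[of r j "Suc k"]
      by (cases "w \<in> ?S' (Suc k)") (auto simp: restrict_cochain_def[of "?S' (Suc k)"] diff_on_def)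
  qed
  show "\<exists>y\<in>cochains_on E (?S k). diff_on (?S (Suc k)) y = x"
    if x: "x \<in> cochains_on E (?S (Suc k))" and dx: "diff_on (?S (Suc (Suc k))) x = 0"
      and px: "restrict_cochain (?S' (Suc k)) x = 0"
  proof -
    have x0: "x w = 0" if "sorted_below r (Suc j) w" for w
    proof (cases "w \<in> ?S (Suc k)")
      case True
      then have "w \<in> ?S' (Suc k)" using that by (simp add: stage_def)
      then show ?thesis using fun_cong[OF px, of w] by (simp add: restrict_cochain_def)
    qed (use x in \<open>simp add: cochains_on_def\<close>)
    show ?thesis using homotopy_cochains_on[OF x x0 dx] diff_on_homotopy[OF x x0 dx] by blast
  qed
  show "\<exists>z\<in>cochains_on E (?S k). diff_on (?S (Suc k)) z = 0 \<and> restrict_cochain (?S' k) z = x"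
    if "x \<in> cochains_on E (?S' k)" "diff_on (?S' (Suc k)) x = 0"
    by (rule lift_cocycle[OF that])
next
  fix x :: "('i, 'e, 'k) cochain"
  assume x: "x \<in> cochains_on E (stage r j 0)" and px: "restrict_cochain (stage r (Suc j) 0) x = 0"
  \<comment> \<open>Sequences of length one satisfy every ordering condition, so in degree 0 the
    restriction is the identity.\<close>
  have "stage r (Suc j) 0 = stage r j 0"
    by (auto simp: stage_def cech_simplices_def sorted_below_def length_Suc_conv)
  then have "restrict_cochain (stage r (Suc j) 0) x = x"
    using x by (auto simp: restrict_cochain_def cochains_on_def)
  then show "x = 0" using px by simp
qed (rule cochain_complex_stage linear_restrict_cochain)+

end

lemma betti_stage:
  assumes r: "bij_betw r (basic_cover A) {..<n}" and "j \<le> n"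
  shows "cochain_complex.betti (cochain_scale :: 'k::field \<Rightarrow> ('i, 'e, 'k) cochain \<Rightarrow> _)
      (\<lambda>k. cochains_on E (stage r 0 k)) (\<lambda>k. diff_on (stage r 0 (Suc k))) k =
    cochain_complex.betti (cochain_scale :: 'k \<Rightarrow> ('i, 'e, 'k) cochain \<Rightarrow> _)
      (\<lambda>k. cochains_on E (stage r j k)) (\<lambda>k. diff_on (stage r j (Suc k))) k"
  using assms(2)
proof (induction j)
  case (Suc j)
  have "j \<in> r ` basic_cover A" using r Suc.prems by (auto simp: bij_betw_def)
  then obtain v where "v \<in> basic_cover A" "r v = j" by blast
  then show ?case
    using Suc betti_stage_Suc[where 'k = 'k, OF bij_betw_imp_inj_on[OF r]] by simp
qed simp

section \<open>Identification of stage 0 with the Cech complex\<close>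

lemma cech_cohomology_eq:
  fixes r :: "'i set set \<Rightarrow> nat"
  defines "C \<equiv> \<lambda>k. cochains_on E (stage r 0 k) :: ('i, 'e, 'k::field) cochain set"
    and "d \<equiv> \<lambda>k. diff_on (stage r 0 (Suc k))"
  shows "(cech_cohomology A E k :: ('k, ('i, 'e, 'k) cochain set) module) =
    quotient_module (sub_mod cochain_scale (cochain_complex.cocycles C d k))
      (cochain_complex.coboundaries C d k)"
proof -
  interpret C: cochain_complex cochain_scale C d
    unfolding C_def d_def by (rule cochain_complex_stage)
  have cochains: "cech_cochains A E l = C l" for l
    by (simp add: cech_cochains_def C_def cochains_on_def stage_0 zero_fun_def)
  have diff: "cech_diff A l f = d l f" for l and f :: "('i, 'e, 'k) cochain"
  proof (intro ext)
    fix w \<omega> x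
    show "cech_diff A l f w \<omega> x = d l f w \<omega> x"
    proof (cases "w \<in> stage r 0 (Suc l)")
      case True
      \<comment> \<open>A simplex of degree \<open>Suc l\<close> has \<open>l + 2\<close> entries,
        hence faces numbered from 0 to \<open>Suc l\<close>.\<close>
      then have len: "{..Suc l} = {..<length w}" by (auto simp: stage_def cech_simplices_def)
      have "d l f w \<omega> x = delta (\<lambda>u. section_restrict (\<Inter>(set w)) (f u) \<omega> x) w"
        using True by (simp add: d_def diff_on_def delta_apply)
      also have "\<dots> = cech_diff A l f w \<omega> x"
        unfolding delta_eq_sum using True len by (simp add: cech_diff_def stage_0)
      finally show ?thesis by simp
    qed (simp add: cech_diff_def d_def diff_on_def stage_0)
  qed
  have "cech_cocycles A E k = C.cocycles k"
    by (simp add: cech_cocycles_def C.cocycles_def cochains diff zero_fun_def)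
  moreover have "cech_coboundaries A E k = C.coboundaries k"
    by (cases k) (simp_all add: cochains diff zero_fun_def image_def)
  moreover have "(\<lambda>f g w \<omega> x. f w \<omega> x + g w \<omega> x) = ((+) :: ('i, 'e, 'k) cochain \<Rightarrow> _)"
    by (intro ext) simp
  \<comment> \<open>This is an equality of records, which is why \<open>sub_mod\<close> has the same
    \<open>undefined\<close> fields as \<open>cocycle_space\<close>.\<close>
  ultimately show ?thesis
    by (simp add: cech_cohomology_def cocycle_space_def sub_mod_def zero_fun_def)
qed

lemma
  shows fin_dim_cech_cohomology: "vectorspace.fin_dim class_ring
      (cech_cohomology A E k :: ('k::field, ('i, 'e, 'k) cochain set) module)"
    and cech_betti_eq: "cech_betti TYPE('k) A E k =
      cochain_complex.betti (cochain_scale :: 'k \<Rightarrow> ('i, 'e, 'k) cochain \<Rightarrow> _)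
        (\<lambda>k. cochains_on E (stage r 0 k)) (\<lambda>k. diff_on (stage r 0 (Suc k))) k"
proof -
  interpret C: cochain_complex "cochain_scale :: 'k \<Rightarrow> ('i, 'e, 'k) cochain \<Rightarrow> _"
    "\<lambda>k. cochains_on E (stage r 0 k)" "\<lambda>k. diff_on (stage r 0 (Suc k))"
    by (rule cochain_complex_stage)
  show "vectorspace.fin_dim class_ring (cech_cohomology A E k :: ('k, ('i, 'e, 'k) cochain set) module)"
    unfolding cech_cohomology_eq[of k r] by (rule C.fin_dim_cohomology)
  show "cech_betti TYPE('k) A E k =
      cochain_complex.betti (cochain_scale :: 'k \<Rightarrow> ('i, 'e, 'k) cochain \<Rightarrow> _)
        (\<lambda>k. cochains_on E (stage r 0 k)) (\<lambda>k. diff_on (stage r 0 (Suc k))) k"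
    unfolding cech_betti_def cech_cohomology_eq[of k r] by (rule C.dim_cohomology)
qed


section \<open>Increasing sequences and the nerve\<close>

lemma strictly_increasing_stage:
  assumes r: "bij_betw r (basic_cover A) {..<n}" and w: "w \<in> stage r n k"
  shows "sorted_wrt (<) (map r w)"
proof -
  have *: "sorted_wrt (\<lambda>x y. r y < n \<longrightarrow> r x < r y) w" "set w \<subseteq> basic_cover A"
    using w by (simp_all add: stage_def sorted_below_def cech_simplices_def)
  have lt: "r y < n" if "y \<in> set w" for y using r *(2) that by (auto simp: bij_betw_def)
  show ?thesis unfolding sorted_wrt_map
    by (rule sorted_wrt_mono_rel[OF _ *(1)]) (use lt in blast)
qed

lemma card_set_stage:
  assumes "bij_betw r (basic_cover A) {..<n}" and "w \<in> stage r n k"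
  shows "card (set w) = Suc k"
proof -
  have "distinct w"
    using strictly_increasing_stage[OF assms] by (auto simp: strict_sorted_iff distinct_map)
  then show ?thesis using assms(2) by (simp add: distinct_card stage_def cech_simplices_def)
qed

definition nerve :: "'i set set set set" where
  "nerve = {S. S \<subseteq> basic_cover A \<and> S \<noteq> {} \<and> \<Inter>S \<noteq> {}}"

lemma finite_nerve: "finite nerve"
  by (rule finite_subset[of _ "Pow (basic_cover A)"]) (auto simp: nerve_def finite_cover)

text \<open>A finite set of members has exactly one enumeration by increasing rank.\<close>

lemma bij_betw_stage_nerve:
  assumes r: "bij_betw r (basic_cover A) {..<n}"
  shows "bij_betw set (stage r n k) {S \<in> nerve. card S = Suc k}"
proof (rule bij_betw_imageI)
  show "inj_on set (stage r n k)"
  proof (rule inj_onI)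
    fix w w' assume w: "w \<in> stage r n k" and w': "w' \<in> stage r n k" and eq: "set w = set w'"
    have "map r w = map r w'"
      by (rule strict_sorted_equal[OF strictly_increasing_stage[OF r w'] strictly_increasing_stage[OF r w]])
        (simp add: eq)
    moreover have "inj_on r (set w \<union> set w')"
      by (rule inj_on_subset[OF bij_betw_imp_inj_on[OF r]])
        (use w w' in \<open>simp add: stage_def cech_simplices_def\<close>)
    ultimately show "w = w'" by (simp add: inj_on_map_eq_map)
  qed
  show "set ` stage r n k = {S \<in> nerve. card S = Suc k}"
  proof (intro equalityI subsetI)
    fix S assume "S \<in> set ` stage r n k"
    then obtain w where w: "w \<in> stage r n k" "S = set w" by blast
    then have "length w = Suc k" "set w \<subseteq> basic_cover A" "\<Inter>(set w) \<noteq> {}"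
      by (simp_all add: stage_def cech_simplices_def)
    then show "S \<in> {S \<in> nerve. card S = Suc k}"
      using card_set_stage[OF r w(1)] w(2) unfolding nerve_def by force
  next
    fix S assume "S \<in> {S \<in> nerve. card S = Suc k}"
    then have S: "S \<subseteq> basic_cover A" "\<Inter>S \<noteq> {}" "card S = Suc k" by (simp_all add: nerve_def)
    have finS: "finite S" by (rule finite_subset[OF S(1) finite_cover])
    have inj: "inj_on r S" by (rule inj_on_subset[OF bij_betw_imp_inj_on[OF r] S(1)])
    define w where "w = map (inv_into S r) (sorted_list_of_set (r ` S))"
    have set_w: "set w = S" using finS inj by (simp add: w_def image_image)
    have "map r w = map (\<lambda>x. x) (sorted_list_of_set (r ` S))"
      unfolding w_def map_map by (rule map_cong) (use finS in \<open>auto simp: f_inv_into_f\<close>)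
    then have map_w: "map r w = sorted_list_of_set (r ` S)" by simp
    have "sorted_wrt (<) (map r w)" unfolding map_w by simp
    then have "sorted_below r n w"
      unfolding sorted_below_def sorted_wrt_map by (rule sorted_wrt_mono_rel[rotated]) blast
    moreover have "length w = Suc k" using S(3) inj by (simp add: w_def card_image)
    ultimately have "w \<in> stage r n k"
      using S set_w by (simp add: stage_def cech_simplices_def)
    then show "S \<in> set ` stage r n k" using set_w by blast
  qed
qed

text \<open>The Betti numbers are those of stage \<open>n\<close>, where \<open>n\<close> is the
  number of members of the covering. An increasing sequence has at most \<open>n\<close> entries, so
  the cochains vanish from degree \<open>n\<close> on. \<open>euler_poincare\<close> then turns the
  sum into one of dimensions.\<close>

lemma
  shows finite_betti_support: "finite {k. cech_betti TYPE('k::field) A E k \<noteq> 0}"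
    and suminf_betti: "(\<Sum>k. (-1) ^ k * int (cech_betti TYPE('k) A E k)) =
      (\<Sum>S\<in>nerve. (-1) ^ (card S - 1) * int (card (PiE (\<Union>(\<Inter>S)) E)))"
proof -
  define n where "n = card (basic_cover A)"
  obtain r where r: "bij_betw r (basic_cover A) {..<n}"
    using ex_bij_betw_finite_nat[OF finite_cover] unfolding n_def lessThan_atLeast0 by blast
  interpret C: cochain_complex "cochain_scale :: 'k \<Rightarrow> ('i, 'e, 'k) cochain \<Rightarrow> _"
    "\<lambda>k. cochains_on E (stage r n k)" "\<lambda>k. diff_on (stage r n (Suc k))"
    by (rule cochain_complex_stage)
  let ?N = "\<lambda>S. int (card (PiE (\<Union>(\<Inter>S)) E))"
  have betti: "cech_betti TYPE('k) A E k = C.betti k" for k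
    unfolding cech_betti_eq[where 'k = 'k and r = r] by (rule betti_stage[OF r order_refl])
  have card_le: "card S \<le> n" if "S \<in> nerve" for S
    using card_mono[OF finite_cover, of S] that by (simp add: nerve_def n_def)
  have "stage r n k = {}" if "n \<le> k" for k
  proof (rule equals0I)
    fix w assume "w \<in> stage r n k"
    then have "set w \<in> {S \<in> nerve. card S = Suc k}"
      by (rule bij_betwE[OF bij_betw_stage_nerve[OF r], rule_format])
    then show False using card_le[of "set w"] that by simp
  qed
  then have C0: "cochains_on E (stage r n k) = {0 :: ('i, 'e, 'k) cochain}" if "n \<le> k" for k
    using that by (auto simp: cochains_on_def)
  have zero: "C.betti k = 0" if "n \<le> k" for k
    by (rule C.betti_eq_0[OF C0 that])
  have "{k. cech_betti TYPE('k) A E k \<noteq> 0} \<subseteq> {..<n}"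
    unfolding betti using zero not_less by blast
  then show "finite {k. cech_betti TYPE('k) A E k \<noteq> 0}" by (rule finite_subset) simp
  have "(\<Sum>k. (-1) ^ k * int (cech_betti TYPE('k) A E k)) = (\<Sum>k<n. (-1) ^ k * int (C.betti k))"
    unfolding betti by (rule suminf_finite) (use zero in auto)
  also have "\<dots> = (\<Sum>k<n. (-1) ^ k * int (\<Sum>w\<in>stage r n k. card (PiE (\<Union>(\<Inter>(set w))) E)))"
    using C.euler_poincare[OF C0] by (simp only: sdim_stage)
  also have "\<dots> = (\<Sum>k<n. \<Sum>S | S \<in> nerve \<and> card S - 1 = k. (-1) ^ (card S - 1) * ?N S)"
  proof (rule sum.cong[OF refl])
    fix k
    \<comment> \<open>Simplices of the nerve are non-empty, so \<open>card S - 1\<close> is their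
      true degree and is not truncated.\<close>
    have pos: "card S \<noteq> 0" if "S \<in> nerve" for S
      using that finite_subset[OF _ finite_cover, of S] by (auto simp: nerve_def)
    have "(-1) ^ k * int (\<Sum>w\<in>stage r n k. card (PiE (\<Union>(\<Inter>(set w))) E)) =
        (\<Sum>w\<in>stage r n k. (-1) ^ k * ?N (set w))"
      by (simp add: sum_distrib_left)
    also have "\<dots> = (\<Sum>S | S \<in> nerve \<and> card S = Suc k. (-1) ^ k * ?N S)"
      by (rule sum.reindex_bij_betw[OF bij_betw_stage_nerve[OF r], of "\<lambda>S. (-1) ^ k * ?N S"])
    also have "\<dots> = (\<Sum>S | S \<in> nerve \<and> card S - 1 = k. (-1) ^ (card S - 1) * ?N S)"
      by (rule sum.cong) (use pos in force)+
    finally show "(-1) ^ k * int (\<Sum>w\<in>stage r n k. card (PiE (\<Union>(\<Inter>(set w))) E)) =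
        (\<Sum>S | S \<in> nerve \<and> card S - 1 = k. (-1) ^ (card S - 1) * ?N S)" .
  qed
  also have "\<dots> = (\<Sum>S\<in>nerve. (-1) ^ (card S - 1) * ?N S)"
  proof (rule sum.group[OF finite_nerve])
    show "(\<lambda>S. card S - 1) ` nerve \<subseteq> {..<n}"
    proof
      fix k assume "k \<in> (\<lambda>S. card S - 1) ` nerve"
      then obtain S where S: "S \<in> nerve" "k = card S - 1" by blast
      then have "S \<noteq> {}" "finite S" using finite_subset[OF _ finite_cover, of S] by (auto simp: nerve_def)
      then have "card S > 0" by (simp add: card_gt_0_iff)
      then show "k \<in> {..<n}" using card_le[OF S(1)] S(2) by simp
    qed
  qed simp
  finally show "(\<Sum>k. (-1) ^ k * int (cech_betti TYPE('k) A E k)) =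
      (\<Sum>S\<in>nerve. (-1) ^ (card S - 1) * ?N S)" .
qed

end

section \<open>Moebius inversion\<close>

text \<open>The sum is the expansion of the product of the factors \<open>-1 + 1\<close> over
  \<open>X\<close>.\<close>

lemma sum_Pow_alternating:
  assumes "finite X" "X \<noteq> {}"
  shows "(\<Sum>S\<in>Pow X. (-1) ^ card S) = (0 :: int)"
proof -
  have "(\<Sum>S\<in>Pow X. (-1) ^ card S) = (\<Sum>S\<in>Pow X. (\<Prod>x\<in>S. -1) * (\<Prod>x\<in>X - S. 1 :: int))"
    by simp
  also have "\<dots> = (\<Prod>x\<in>X. -1 + 1)" by (rule prod_add[OF assms(1), symmetric])
  finally show ?thesis using assms by (simp add: card_gt_0_iff)
qed

text \<open>The system is triangular: the upper sum at \<gamma> involves \<gamma> and the members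
  strictly above it. The induction is on the number of the latter.\<close>

lemma upper_sums_unique:
  fixes f g :: "'i set \<Rightarrow> int"
  assumes "finite A" and fg: "\<And>\<gamma>. \<gamma> \<in> A \<Longrightarrow> (\<Sum>\<beta> | \<beta> \<in> A \<and> \<gamma> \<subseteq> \<beta>. f \<beta>) = (\<Sum>\<beta> | \<beta> \<in> A \<and> \<gamma> \<subseteq> \<beta>. g \<beta>)"
    and "\<gamma> \<in> A"
  shows "f \<gamma> = g \<gamma>"
  using assms(3)
proof (induction "card {\<beta> \<in> A. \<gamma> \<subset> \<beta>}" arbitrary: \<gamma> rule: less_induct)
  case less
  have split: "{\<beta>. \<beta> \<in> A \<and> \<gamma> \<subseteq> \<beta>} = insert \<gamma> {\<beta> \<in> A. \<gamma> \<subset> \<beta>}" using less.prems by blast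
  have "f \<beta> = g \<beta>" if \<beta>: "\<beta> \<in> {\<beta> \<in> A. \<gamma> \<subset> \<beta>}" for \<beta>
  proof (rule less.hyps)
    show "card {\<delta> \<in> A. \<beta> \<subset> \<delta>} < card {\<beta> \<in> A. \<gamma> \<subset> \<beta>}"
      by (rule psubset_card_mono) (use \<beta> \<open>finite A\<close> in auto)
  qed (use \<beta> in simp)
  then have "sum f {\<beta> \<in> A. \<gamma> \<subset> \<beta>} = sum g {\<beta> \<in> A. \<gamma> \<subset> \<beta>}" by (rule sum.cong[OF refl])
  then show ?case using fg[OF less.prems] \<open>finite A\<close> unfolding split by simp
qed

text \<open>After the sums are exchanged, the inner one is a defining sum of \<mu>, because terms
  with \<beta> not contained in \<alpha> vanish. Only \<open>\<alpha> = \<gamma>\<close>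
  contributes.\<close>

lemma upper_sum_moebius:
  assumes "finite A" "is_moebius A \<mu>" "\<gamma> \<in> A"
  shows "(\<Sum>\<beta> | \<beta> \<in> A \<and> \<gamma> \<subseteq> \<beta>. \<Sum>\<alpha>\<in>A. \<mu> \<alpha> \<beta>) = 1"
proof -
  have "(\<Sum>\<beta> | \<beta> \<in> A \<and> \<gamma> \<subseteq> \<beta>. \<Sum>\<alpha>\<in>A. \<mu> \<alpha> \<beta>) = (\<Sum>\<alpha>\<in>A. \<Sum>\<beta> | \<beta> \<in> A \<and> \<gamma> \<subseteq> \<beta>. \<mu> \<alpha> \<beta>)"
    by (rule sum.swap)
  also have "\<dots> = (\<Sum>\<alpha>\<in>A. if \<alpha> = \<gamma> then 1 else 0)"
  proof (rule sum.cong[OF refl])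
    fix \<alpha> assume \<alpha>: "\<alpha> \<in> A"
    have "(\<Sum>\<beta> | \<beta> \<in> A \<and> \<gamma> \<subseteq> \<beta>. \<mu> \<alpha> \<beta>) = (\<Sum>\<beta> | \<beta> \<in> A \<and> \<beta> \<subseteq> \<alpha> \<and> \<gamma> \<subseteq> \<beta>. \<mu> \<alpha> \<beta>)"
      by (rule sum.mono_neutral_right) (use assms \<alpha> in \<open>auto simp: is_moebius_def\<close>)
    also have "\<dots> = (if \<alpha> = \<gamma> then 1 else 0)"
    proof (cases "\<gamma> \<subseteq> \<alpha>")
      case True
      then show ?thesis using assms \<alpha> by (simp add: is_moebius_def)
    next
      case False
      then have empty: "{\<beta>. \<beta> \<in> A \<and> \<beta> \<subseteq> \<alpha> \<and> \<gamma> \<subseteq> \<beta>} = {}" by blast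
      show ?thesis unfolding empty using False by auto
    qed
    finally show "(\<Sum>\<beta> | \<beta> \<in> A \<and> \<gamma> \<subseteq> \<beta>. \<mu> \<alpha> \<beta>) = (if \<alpha> = \<gamma> then 1 else 0)" .
  qed
  also have "\<dots> = 1" using assms by simp
  finally show ?thesis .
qed

context finite_hypergraph
begin

text \<open>The simplices counted are the non-empty sets of members of the covering that contain
  \<gamma>. They form a full simplex, whose Euler characteristic is 1.\<close>

lemma upper_sum_nerve:
  assumes \<gamma>: "\<gamma> \<in> A"
  shows "(\<Sum>\<beta> | \<beta> \<in> A \<and> \<gamma> \<subseteq> \<beta>. \<Sum>S | S \<in> nerve \<and> \<Union>(\<Inter>S) = \<beta>. (-1) ^ (card S - 1)) = (1 :: int)"
proof -
  let ?X = "{U \<in> basic_cover A. \<gamma> \<in> U}"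
  have finX: "finite ?X" using finite_cover by simp
  have top: "\<Union>(\<Inter>S) \<in> A" "\<Inter>S = basic_open A (\<Union>(\<Inter>S))" if "S \<in> nerve" for S
    using Union_Inter_cover[of S] that finite_subset[OF _ finite_cover, of S]
    by (auto simp: nerve_def simp del: Union_iff Inter_iff)
  have mem: "\<gamma> \<in> \<Inter>S \<longleftrightarrow> \<gamma> \<subseteq> \<Union>(\<Inter>S)" if "S \<in> nerve" for S
  proof -
    have "\<gamma> \<in> \<Inter>S \<longleftrightarrow> \<gamma> \<in> basic_open A (\<Union>(\<Inter>S))" using top(2)[OF that] by simp
    also have "\<dots> \<longleftrightarrow> \<gamma> \<subseteq> \<Union>(\<Inter>S)" using \<gamma> by (simp add: basic_open_def)
    finally show ?thesis .
  qed
  have X: "{S. S \<in> nerve \<and> \<gamma> \<subseteq> \<Union>(\<Inter>S)} = Pow ?X - {{}}"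
  proof -
    have "S \<in> nerve \<and> \<gamma> \<subseteq> \<Union>(\<Inter>S) \<longleftrightarrow> S \<in> Pow ?X - {{}}" for S
    proof -
      have "S \<in> nerve \<and> \<gamma> \<subseteq> \<Union>(\<Inter>S) \<longleftrightarrow> S \<in> nerve \<and> \<gamma> \<in> \<Inter>S" using mem by blast
      also have "\<dots> \<longleftrightarrow> S \<subseteq> basic_cover A \<and> S \<noteq> {} \<and> \<gamma> \<in> \<Inter>S"
        unfolding nerve_def mem_Collect_eq by (metis empty_iff)
      also have "\<dots> \<longleftrightarrow> S \<in> Pow ?X - {{}}" by auto
      finally show ?thesis .
    qed
    then show ?thesis by (simp only: set_eq_iff mem_Collect_eq simp_thms)
  qed
  have "(\<Sum>\<beta> | \<beta> \<in> A \<and> \<gamma> \<subseteq> \<beta>. \<Sum>S | S \<in> nerve \<and> \<Union>(\<Inter>S) = \<beta>. (-1) ^ (card S - 1)) =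
      (\<Sum>\<beta> | \<beta> \<in> A \<and> \<gamma> \<subseteq> \<beta>. \<Sum>S | S \<in> {S. S \<in> nerve \<and> \<gamma> \<subseteq> \<Union>(\<Inter>S)} \<and> \<Union>(\<Inter>S) = \<beta>. (-1) ^ (card S - 1) :: int)"
    by (intro sum.cong refl Collect_cong) blast
  also have "\<dots> = (\<Sum>S | S \<in> nerve \<and> \<gamma> \<subseteq> \<Union>(\<Inter>S). (-1) ^ (card S - 1))"
    by (rule sum.group) (use finite_A finite_nerve top(1) in auto)
  also have "\<dots> = (\<Sum>S\<in>Pow ?X - {{}}. - ((-1) ^ card S))"
    unfolding X
  proof (rule sum.cong[OF refl])
    fix S assume S: "S \<in> Pow ?X - {{}}"
    then have "card S \<noteq> 0" using finite_subset[OF _ finX, of S] by auto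
    then show "(-1) ^ (card S - 1) = - ((-1 :: int) ^ card S)" by (cases "card S") auto
  qed
  \<comment> \<open>The subtracted 1 is the term of the empty set.\<close>
  also have "\<dots> = - ((\<Sum>S\<in>Pow ?X. (-1) ^ card S) - 1)"
    using finX by (simp add: sum_negf sum_diff1)
  also have "\<dots> = 1"
  proof -
    have "basic_open A \<gamma> \<in> ?X" using \<gamma> by (auto simp: basic_cover_def basic_open_def)
    then show ?thesis using sum_Pow_alternating[OF finX] by auto
  qed
  finally show ?thesis .
qed

text \<open>The simplices are grouped by the index of their intersection. The resulting coefficients
  and the column sums of \<mu> have the same upper sums, so \<open>upper_sums_unique\<close>
  identifies them.\<close>

lemma sum_nerve_eq_moebius:
  fixes f :: "'i set \<Rightarrow> int"
  assumes "is_moebius A \<mu>"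
  shows "(\<Sum>S\<in>nerve. (-1) ^ (card S - 1) * f (\<Union>(\<Inter>S))) = (\<Sum>\<alpha>\<in>A. \<Sum>\<beta>\<in>A. \<mu> \<alpha> \<beta> * f \<beta>)"
proof -
  let ?h = "\<lambda>\<beta>. \<Sum>S | S \<in> nerve \<and> \<Union>(\<Inter>S) = \<beta>. (-1) ^ (card S - 1) :: int"
  have eq: "?h \<beta> = (\<Sum>\<alpha>\<in>A. \<mu> \<alpha> \<beta>)" if "\<beta> \<in> A" for \<beta>
    by (rule upper_sums_unique[OF finite_A _ that])
      (simp only: upper_sum_nerve upper_sum_moebius[OF finite_A assms])
  have "(\<Sum>S\<in>nerve. (-1) ^ (card S - 1) * f (\<Union>(\<Inter>S))) =
      (\<Sum>\<beta>\<in>A. \<Sum>S | S \<in> nerve \<and> \<Union>(\<Inter>S) = \<beta>. (-1) ^ (card S - 1) * f (\<Union>(\<Inter>S)))"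
  proof (rule sum.group[symmetric, OF finite_nerve finite_A])
    show "(\<lambda>S. \<Union>(\<Inter>S)) ` nerve \<subseteq> A"
      using Union_Inter_cover(1) finite_subset[OF _ finite_cover] unfolding nerve_def by blast
  qed
  also have "\<dots> = (\<Sum>\<beta>\<in>A. ?h \<beta> * f \<beta>)"
    by (simp add: sum_distrib_right)
  also have "\<dots> = (\<Sum>\<beta>\<in>A. (\<Sum>\<alpha>\<in>A. \<mu> \<alpha> \<beta>) * f \<beta>)"
    by (rule sum.cong[OF refl]) (simp only: eq)
  also have "\<dots> = (\<Sum>\<alpha>\<in>A. \<Sum>\<beta>\<in>A. \<mu> \<alpha> \<beta> * f \<beta>)"
    unfolding sum_distrib_right by (rule sum.swap)
  finally show ?thesis .
qed

end

theorem theorem5p16: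
  fixes I :: "'i set" and A :: "'i set set" and E :: "'i \<Rightarrow> 'e set"
    and \<mu> :: "'i set \<Rightarrow> 'i set \<Rightarrow> int"
  assumes "hypergraph I A" and "finite A" and "weak_intersection_property A"
    and "\<And>i. i \<in> I \<Longrightarrow> E i \<noteq> {}" and "\<And>i. i \<in> I \<Longrightarrow> finite (E i)"
    and "is_moebius A \<mu>"
  shows "(\<forall>k. vectorspace.fin_dim class_ring
               (cech_cohomology A E k :: ('k::field, ('i, 'e, 'k) cochain set) module)) \<and>
         finite {k. cech_betti TYPE('k) A E k \<noteq> 0} \<and>
         euler_char TYPE('k) A E = (\<Sum>k. (-1) ^ k * int (cech_betti TYPE('k) A E k)) \<and>
         (\<Sum>k. (-1) ^ k * int (cech_betti TYPE('k) A E k)) =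
           (\<Sum>\<alpha>\<in>A. \<Sum>\<beta>\<in>A. \<mu> \<alpha> \<beta> * int (card (PiE \<beta> E)))"
proof -
  interpret finite_hypergraph I A E
    using assms by unfold_locales auto
  show ?thesis
    using fin_dim_cech_cohomology finite_betti_support
      sum_nerve_eq_moebius[OF assms(6), of "\<lambda>\<beta>. int (card (PiE \<beta> E))"]
    by (auto simp: euler_char_def suminf_betti)
qed

end
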